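(* Let $R\ge1$, let $\mathfrak{g},\mathfrak{h}$ be AE-Lie algebras over $\mathbb{K}$, $z\in\mathbb{K}$, and let $\phi\colon\mathfrak{g}\to\mathfrak{h}$ be a continuous homomorphism of Lie algebras. Then $\phi$ lifts to a continuous unital homomorphism of locally convex algebras $\Phi_z\colon\mathcal{U}_R(\mathfrak{g}_z)\to\mathcal{U}_R(\mathfrak{h}_z)$, i.e. $\Phi_z\circ\iota_{\mathfrak{g}}=\iota_{\mathfrak{h}}\circ\phi$ for the canonical inclusions $\iota_{\mathfrak g}\colon\mathfrak{g}\to\mathcal{U}(\mathfrak{g}_z)$ and $\iota_{\mathfrak h}\colon\mathfrak{h}\to\mathcal{U}(\mathfrak{h}_z)$.
   Context: $\mathbb{K}$ is $\mathbb{R}$ or $\mathbb{C}$. An AE-Lie algebra is a (Hausdorff) locally convex Lie algebra with continuous bracket in which every continuous seminorm $p$ has an asymptotic estimate: a continuous seminorm $q$ with $p(w_n(x_1,\ldots,x_n))\le q(x_1)\cdots q(x_n)$ for all $n\ge1$, all $x_i$ in the Lie algebra and all words $w_n$ made out of $n-1$ Lie brackets of $x_1,\ldots,x_n$ with arbitrary bracketing. $p^n$ is the $n$-th projective tensor power of a continuous seminorm $p$ ($p^0=|\cdot|$), $p_R=\sum_{n\ge0}n!^Rp^n$, and $\mathrm{S}_R^\bullet(\mathfrak{g})$ is the symmetric tensor algebra (symmetric tensors inside $\mathrm{T}^\bullet(\mathfrak{g})$) with the topology of all $p_R$, $p$ a continuous seminorm on $\mathfrak{g}$. $\mathcal{U}(\mathfrak{g}_z)=\mathrm{T}^\bullet(\mathfrak{g})/\langle\xi\otimes\eta-\eta\otimes\xi-z[\xi,\eta]\rangle$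 with product $\odot$, and $\mathfrak{q}_z\colon \mathrm{S}^\bullet(\mathfrak{g})\to\mathcal{U}(\mathfrak{g}_z)$ is the linear isomorphism $\mathfrak{q}_z(\xi_1\cdots\xi_n)=\frac1{n!}\sum_\sigma\xi_{\sigma(1)}\odot\cdots\odot\xi_{\sigma(n)}$. $\mathcal{U}_R(\mathfrak{g}_z)$ is $\mathcal{U}(\mathfrak{g}_z)$ with the topology making $\mathfrak{q}_z\colon \mathrm{S}_R^\bullet(\mathfrak{g})\to\mathcal{U}_R(\mathfrak{g}_z)$ a homeomorphism; likewise for $\mathfrak{h}$. *)

theory Defs
  imports
    "HOL-Analysis.Analysis"
    "HOL-Algebra.QuotRing"
    "HOL-Algebra.Module"
    "HOL-Combinatorics.Permutations"
    "HOL-Library.Poly_Mapping"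
begin

text \<open>
  The ground field is a type \<open>'k\<close> of class \<^class>\<open>real_normed_field\<close>: \<^typ>\<open>real\<close> and \<^typ>\<open>complex\<close> are
  instances and, by the Gelfand--Mazur theorem, every instance is isometrically isomorphic to
  one of them.  A Lie algebra is a type \<open>'g\<close> whose addition and topology come from type classes,
  with an explicit scalar multiplication and an explicit bracket.
\<close>

section \<open>Locally convex Lie algebras with asymptotic estimates\<close>

definition seminorm :: "('k::real_normed_field \<Rightarrow> 'g::ab_group_add \<Rightarrow> 'g) \<Rightarrow> ('g \<Rightarrow> real) \<Rightarrow> bool"
  where "seminorm scl p \<longleftrightarrow>
    (\<forall>x y. p (x + y) \<le> p x + p y) \<and> (\<forall>c x. p (scl c x) = norm c * p x)"

definition continuous_seminorm ::
    "('k::real_normed_field \<Rightarrow> 'g::{topological_space, ab_group_add} \<Rightarrow> 'g) \<Rightarrow> ('g \<Rightarrow> real) \<Rightarrow> bool"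
  where "continuous_seminorm scl p \<longleftrightarrow> seminorm scl p \<and> continuous_on UNIV p"

definition convex_wrt :: "('k::real_normed_field \<Rightarrow> 'g::ab_group_add \<Rightarrow> 'g) \<Rightarrow> 'g set \<Rightarrow> bool"
  where "convex_wrt scl V \<longleftrightarrow>
    (\<forall>x\<in>V. \<forall>y\<in>V. \<forall>t\<in>{0..1::real}. scl (of_real (1 - t)) x + scl (of_real t) y \<in> V)"

locale locally_convex_space = vector_space scl
  for scl :: "'k::real_normed_field \<Rightarrow> 'g::{topological_ab_group_add, t2_space} \<Rightarrow> 'g" +
  assumes continuous_scale: "continuous_on UNIV (\<lambda>(c, x). scl c x)"
    and locally_convex: "\<And>W. open W \<Longrightarrow> 0 \<in> W \<Longrightarrow> \<exists>V. open V \<and> 0 \<in> V \<and> V \<subseteq> W \<and> convex_wrt scl V"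

locale lie_algebra = vector_space scl
  for scl :: "'k::field \<Rightarrow> 'g::ab_group_add \<Rightarrow> 'g" +
  fixes bracket :: "'g \<Rightarrow> 'g \<Rightarrow> 'g"
  assumes linear_left: "\<And>y. Vector_Spaces.linear scl scl (\<lambda>x. bracket x y)"
    and linear_right: "\<And>x. Vector_Spaces.linear scl scl (\<lambda>y. bracket x y)"
    and alternating: "\<And>x. bracket x x = 0"
    and jacobi: "\<And>x y w. bracket x (bracket y w) + bracket y (bracket w x) + bracket w (bracket x y) = 0"

text \<open>\<open>bracket_word b [x\<^sub>1,\<dots>,x\<^sub>n] w\<close>: \<open>w\<close> is the value of some bracketing of \<open>x\<^sub>1,\<dots>,x\<^sub>n\<close>.\<close>

inductive bracket_word :: "('g \<Rightarrow> 'g \<Rightarrow> 'g) \<Rightarrow> 'g list \<Rightarrow> 'g \<Rightarrow> bool"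
  for bracket where
  single: "bracket_word bracket [x] x"
| bracket: "bracket_word bracket xs v \<Longrightarrow> bracket_word bracket ys w \<Longrightarrow>
    bracket_word bracket (xs @ ys) (bracket v w)"

definition asymptotic_estimate :: "('g \<Rightarrow> 'g \<Rightarrow> 'g) \<Rightarrow> ('g \<Rightarrow> real) \<Rightarrow> ('g \<Rightarrow> real) \<Rightarrow> bool"
  where "asymptotic_estimate bracket p q \<longleftrightarrow>
    (\<forall>xs w. bracket_word bracket xs w \<longrightarrow> p w \<le> prod_list (map q xs))"

locale AE_lie_algebra = locally_convex_space scl + lie_algebra scl bracket
  for scl :: "'k::real_normed_field \<Rightarrow> 'g::{topological_ab_group_add, t2_space} \<Rightarrow> 'g"
    and bracket :: "'g \<Rightarrow> 'g \<Rightarrow> 'g" +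
  assumes continuous_bracket: "continuous_on UNIV (\<lambda>(x, y). bracket x y)"
    and AE: "\<And>p. continuous_seminorm scl p \<Longrightarrow>
      \<exists>q. continuous_seminorm scl q \<and> asymptotic_estimate bracket p q"

definition lie_algebra_hom ::
    "('k::field \<Rightarrow> 'g::ab_group_add \<Rightarrow> 'g) \<Rightarrow> ('g \<Rightarrow> 'g \<Rightarrow> 'g) \<Rightarrow>
     ('k \<Rightarrow> 'h::ab_group_add \<Rightarrow> 'h) \<Rightarrow> ('h \<Rightarrow> 'h \<Rightarrow> 'h) \<Rightarrow> ('g \<Rightarrow> 'h) \<Rightarrow> bool"
  where "lie_algebra_hom scale_g bracket_g scale_h bracket_h \<phi> \<longleftrightarrow>
    Vector_Spaces.linear scale_g scale_h \<phi> \<and>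
    (\<forall>x y. \<phi> (bracket_g x y) = bracket_h (\<phi> x) (\<phi> y))"


section \<open>Algebras over the ground field\<close>

text \<open>
  A (not necessarily commutative) algebra is a \<^type>\<open>module_ext\<close> record.  The locale \<open>algebra\<close> of
  the library is restricted to commutative algebras, hence only the record is used.
\<close>

definition algebra_hom ::
    "('k, 'a, 'm) module_scheme \<Rightarrow> ('k, 'b, 'n) module_scheme \<Rightarrow> ('a \<Rightarrow> 'b) set"
  where "algebra_hom A B =
    {h \<in> ring_hom A B. \<forall>c. \<forall>x\<in>carrier A. h (c \<odot>\<^bsub>A\<^esub> x) = c \<odot>\<^bsub>B\<^esub> h x}"

definition quotient_algebra :: "('k, 'a, 'm) module_scheme \<Rightarrow> 'a set \<Rightarrow> ('k, 'a set) module"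
  where "quotient_algebra A I =
    ring.extend (A Quot I) (module.fields (\<lambda>c X. \<Union>x\<in>X. I +>\<^bsub>A\<^esub> (c \<odot>\<^bsub>A\<^esub> x)))"

definition list_product :: "('a, 'm) monoid_scheme \<Rightarrow> 'a list \<Rightarrow> 'a"
  where "list_product A xs = foldr (\<otimes>\<^bsub>A\<^esub>) xs \<one>\<^bsub>A\<^esub>"

text \<open>\<open>1/n! \<Sum>\<^sub>\<sigma> a\<^bsub>\<sigma>(1)\<^esub> \<cdots> a\<^bsub>\<sigma>(n)\<^esub>\<close> in the algebra \<open>A\<close>\<close>

definition symmetrized_product :: "('k::field_char_0, 'a, 'm) module_scheme \<Rightarrow> 'a list \<Rightarrow> 'a"
  where "symmetrized_product A xs = inverse (fact (length xs)) \<odot>\<^bsub>A\<^esub>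
    (\<Oplus>\<^bsub>A\<^esub>\<sigma>\<in>{\<sigma>. \<sigma> permutes {..<length xs}}. list_product A (permute_list \<sigma> xs))"


section \<open>The tensor algebra\<close>

text \<open>
  The tensor algebra is the free associative unital algebra on the set \<open>'g\<close>, i.e. formal linear
  combinations of words over \<open>'g\<close>, modulo the relations that make the inclusion of \<open>'g\<close> linear.
\<close>

datatype 'g fword = Word (letters: "'g list")

instantiation fword :: (type) monoid_add
begin
definition zero_fword :: "'a fword" where "zero_fword = Word []"
definition plus_fword :: "'a fword \<Rightarrow> 'a fword \<Rightarrow> 'a fword"
  where "plus_fword u v = Word (letters u @ letters v)"
instance by standard (simp_all add: zero_fword_def plus_fword_def)
end

type_synonym ('k, 'g) free = "'g fword \<Rightarrow>\<^sub>0 'k"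
type_synonym ('k, 'g) tensor = "('k, 'g) free set"
type_synonym ('k, 'g) env = "('k, 'g) tensor set"

definition free_algebra :: "('k::comm_ring_1, ('k, 'g) free) module"
  where "free_algebra = \<lparr>carrier = UNIV, mult = (*), one = 1, zero = 0, add = (+),
    smult = (\<lambda>c f. Poly_Mapping.single 0 c * f)\<rparr>"

abbreviation gen :: "'g \<Rightarrow> ('k::comm_ring_1, 'g) free"
  where "gen x \<equiv> Poly_Mapping.single (Word [x]) 1"

definition linear_relations :: "('k::comm_ring_1 \<Rightarrow> 'g::ab_group_add \<Rightarrow> 'g) \<Rightarrow> ('k, 'g) free set"
  where "linear_relations scl =
    {gen (x + y) - (gen x + gen y) | x y. True} \<union>
    {gen (scl c x) - Poly_Mapping.single 0 c * gen x | c x. True}"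

definition tensor_ideal :: "('k::comm_ring_1 \<Rightarrow> 'g::ab_group_add \<Rightarrow> 'g) \<Rightarrow> ('k, 'g) free set"
  where "tensor_ideal scl = Idl\<^bsub>free_algebra\<^esub> (linear_relations scl)"

definition tensor_algebra ::
    "('k::comm_ring_1 \<Rightarrow> 'g::ab_group_add \<Rightarrow> 'g) \<Rightarrow> ('k, ('k, 'g) tensor) module"
  where "tensor_algebra scl = quotient_algebra free_algebra (tensor_ideal scl)"

definition tensor_class ::
    "('k::comm_ring_1 \<Rightarrow> 'g::ab_group_add \<Rightarrow> 'g) \<Rightarrow> ('k, 'g) free \<Rightarrow> ('k, 'g) tensor"
  where "tensor_class scl f = tensor_ideal scl +>\<^bsub>free_algebra\<^esub> f"

definition tensor_incl ::
    "('k::comm_ring_1 \<Rightarrow> 'g::ab_group_add \<Rightarrow> 'g) \<Rightarrow> 'g \<Rightarrow> ('k, 'g) tensor"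
  where "tensor_incl scl x = tensor_class scl (gen x)"

subsection \<open>Grading and permutations of tensors\<close>

text \<open>
  \<open>permuted_part n \<sigma> f\<close> extracts the words of length \<open>n\<close> and permutes their letters by \<open>\<sigma>\<close>; on
  tensors this is the degree-\<open>n\<close> component acted on by \<open>\<sigma>\<close>.  As \<open>linear_relations\<close> is
  homogeneous, the union in \<open>permuted_component\<close> is over equal cosets; see
  \<open>permuted_component_class\<close> below.
\<close>

definition permuted_part :: "nat \<Rightarrow> (nat \<Rightarrow> nat) \<Rightarrow> ('k::comm_ring_1, 'g) free \<Rightarrow> ('k, 'g) free"
  where "permuted_part n \<sigma> f =
    (\<Sum>w\<in>{w \<in> Poly_Mapping.keys f. length (letters w) = n}.
      Poly_Mapping.single (Word (permute_list \<sigma> (letters w))) (Poly_Mapping.lookup f w))"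

definition permuted_component ::
    "('k::comm_ring_1 \<Rightarrow> 'g::ab_group_add \<Rightarrow> 'g) \<Rightarrow> nat \<Rightarrow> (nat \<Rightarrow> nat) \<Rightarrow>
     ('k, 'g) tensor \<Rightarrow> ('k, 'g) tensor"
  where "permuted_component scl n \<sigma> t = (\<Union>f\<in>t. tensor_class scl (permuted_part n \<sigma> f))"

definition component ::
    "('k::comm_ring_1 \<Rightarrow> 'g::ab_group_add \<Rightarrow> 'g) \<Rightarrow> nat \<Rightarrow> ('k, 'g) tensor \<Rightarrow> ('k, 'g) tensor"
  where "component scl n t = permuted_component scl n id t"

definition symmetric_tensors ::
    "('k::comm_ring_1 \<Rightarrow> 'g::ab_group_add \<Rightarrow> 'g) \<Rightarrow> ('k, 'g) tensor set"
  where "symmetric_tensors scl =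
    {t \<in> carrier (tensor_algebra scl).
       \<forall>n \<sigma>. \<sigma> permutes {..<n} \<longrightarrow> permuted_component scl n \<sigma> t = component scl n t}"

definition symmetric_product ::
    "('k::field_char_0 \<Rightarrow> 'g::ab_group_add \<Rightarrow> 'g) \<Rightarrow> 'g list \<Rightarrow> ('k, 'g) tensor"
  where "symmetric_product scl xs =
    symmetrized_product (tensor_algebra scl) (map (tensor_incl scl) xs)"

subsection \<open>Projective seminorms and the topology of the symmetric algebra\<close>

text \<open>
  The infimum of \<open>\<Sum>\<^sub>i \<bar>c\<^sub>i\<bar> p(x\<^bsub>i1\<^esub>) \<cdots> p(x\<^bsub>in\<^esub>)\<close> over all representations
  \<open>t = \<Sum>\<^sub>i c\<^sub>i x\<^bsub>i1\<^esub> \<otimes> \<cdots> \<otimes> x\<^bsub>in\<^esub>\<close>; for \<open>n = 0\<close> this is the absolute value on scalars.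
\<close>

definition projective_power ::
    "('k::real_normed_field \<Rightarrow> 'g::ab_group_add \<Rightarrow> 'g) \<Rightarrow> ('g \<Rightarrow> real) \<Rightarrow> nat \<Rightarrow>
     ('k, 'g) tensor \<Rightarrow> real"
  where "projective_power scl p n t =
    Inf {(\<Sum>w\<in>Poly_Mapping.keys f.
            norm (Poly_Mapping.lookup f w) * prod_list (map p (letters w))) | f.
         (\<forall>w\<in>Poly_Mapping.keys f. length (letters w) = n) \<and> tensor_class scl f = t}"

text \<open>Only finitely many components of a tensor are nonzero, so the series below is a finite sum.\<close>

definition tensor_seminorm ::
    "('k::real_normed_field \<Rightarrow> 'g::ab_group_add \<Rightarrow> 'g) \<Rightarrow> real \<Rightarrow> ('g \<Rightarrow> real) \<Rightarrow>
     ('k, 'g) tensor \<Rightarrow> real"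
  where "tensor_seminorm scl R p t =
    suminf (\<lambda>n. fact n powr R * projective_power scl p n (component scl n t))"

definition symmetric_topology ::
    "('k::real_normed_field \<Rightarrow> 'g::{topological_space, ab_group_add} \<Rightarrow> 'g) \<Rightarrow> real \<Rightarrow>
     ('k, 'g) tensor topology"
  where "symmetric_topology scl R =
    topology_generated_by
      {{s \<in> symmetric_tensors scl.
          tensor_seminorm scl R p (s \<ominus>\<^bsub>tensor_algebra scl\<^esub> t) < \<epsilon>} | p t \<epsilon>.
        continuous_seminorm scl p \<and> t \<in> symmetric_tensors scl \<and> \<epsilon> > 0}"


section \<open>The universal enveloping algebra\<close>

definition env_relations ::
    "('k::comm_ring_1 \<Rightarrow> 'g::ab_group_add \<Rightarrow> 'g) \<Rightarrow> ('g \<Rightarrow> 'g \<Rightarrow> 'g) \<Rightarrow> 'k \<Rightarrow> ('k, 'g) tensor set"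
  where "env_relations scl bracket z =
    {(tensor_incl scl x \<otimes>\<^bsub>T\<^esub> tensor_incl scl y \<ominus>\<^bsub>T\<^esub> tensor_incl scl y \<otimes>\<^bsub>T\<^esub> tensor_incl scl x)
        \<ominus>\<^bsub>T\<^esub> z \<odot>\<^bsub>T\<^esub> tensor_incl scl (bracket x y) | T x y. T = tensor_algebra scl}"

definition env_ideal ::
    "('k::comm_ring_1 \<Rightarrow> 'g::ab_group_add \<Rightarrow> 'g) \<Rightarrow> ('g \<Rightarrow> 'g \<Rightarrow> 'g) \<Rightarrow> 'k \<Rightarrow> ('k, 'g) tensor set"
  where "env_ideal scl bracket z = Idl\<^bsub>tensor_algebra scl\<^esub> (env_relations scl bracket z)"

definition env_algebra ::
    "('k::comm_ring_1 \<Rightarrow> 'g::ab_group_add \<Rightarrow> 'g) \<Rightarrow> ('g \<Rightarrow> 'g \<Rightarrow> 'g) \<Rightarrow> 'k \<Rightarrow>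
     ('k, ('k, 'g) env) module"
  where "env_algebra scl bracket z =
    quotient_algebra (tensor_algebra scl) (env_ideal scl bracket z)"

definition env_incl ::
    "('k::comm_ring_1 \<Rightarrow> 'g::ab_group_add \<Rightarrow> 'g) \<Rightarrow> ('g \<Rightarrow> 'g \<Rightarrow> 'g) \<Rightarrow> 'k \<Rightarrow> 'g \<Rightarrow> ('k, 'g) env"
  where "env_incl scl bracket z x =
    env_ideal scl bracket z +>\<^bsub>tensor_algebra scl\<^esub> tensor_incl scl x"

text \<open>
  The quantization map is the linear map on symmetric tensors that sends each symmetric product
  to the symmetrized product of the same elements in the enveloping algebra.  Values outside the
  domain are fixed to \<open>undefined\<close>.
\<close>

definition is_quantization ::
    "('k::field_char_0 \<Rightarrow> 'g::ab_group_add \<Rightarrow> 'g) \<Rightarrow> ('g \<Rightarrow> 'g \<Rightarrow> 'g) \<Rightarrow> 'k \<Rightarrow>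
     (('k, 'g) tensor \<Rightarrow> ('k, 'g) env) \<Rightarrow> bool"
  where "is_quantization scl bracket z q \<longleftrightarrow>
    (let S = symmetric_tensors scl; T = tensor_algebra scl; U = env_algebra scl bracket z in
      q \<in> S \<rightarrow>\<^sub>E carrier U \<and>
      (\<forall>s\<in>S. \<forall>t\<in>S. q (s \<oplus>\<^bsub>T\<^esub> t) = q s \<oplus>\<^bsub>U\<^esub> q t) \<and>
      (\<forall>c. \<forall>s\<in>S. q (c \<odot>\<^bsub>T\<^esub> s) = c \<odot>\<^bsub>U\<^esub> q s) \<and>
      (\<forall>xs. q (symmetric_product scl xs) =
        symmetrized_product U (map (env_incl scl bracket z) xs)))"

definition quantization ::
    "('k::field_char_0 \<Rightarrow> 'g::ab_group_add \<Rightarrow> 'g) \<Rightarrow> ('g \<Rightarrow> 'g \<Rightarrow> 'g) \<Rightarrow> 'k \<Rightarrow>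
     ('k, 'g) tensor \<Rightarrow> ('k, 'g) env"
  where "quantization scl bracket z = (THE q. is_quantization scl bracket z q)"

text \<open>
  The topology transported along the quantization map.  As that map is bijective (by the
  Poincare--Birkhoff--Witt theorem), this is the unique topology on the enveloping algebra for
  which it is a homeomorphism, cf. \<open>homeomorphic_map_quantization\<close> below.
\<close>

definition env_topology ::
    "('k::real_normed_field \<Rightarrow> 'g::{topological_space, ab_group_add} \<Rightarrow> 'g) \<Rightarrow>
     ('g \<Rightarrow> 'g \<Rightarrow> 'g) \<Rightarrow> real \<Rightarrow> 'k \<Rightarrow> ('k, 'g) env topology"
  where "env_topology scl bracket R z = topology (\<lambda>V.
    V \<subseteq> carrier (env_algebra scl bracket z) \<and>
    openin (symmetric_topology scl R)
      {s \<in> symmetric_tensors scl. quantization scl bracket z s \<in> V})"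


section \<open>Well-definedness\<close>

text \<open>
  The grading and the permutation action descend to tensors (\<open>permuted_component_class\<close>), the
  quantization map exists and is unique (\<open>is_quantization_projection\<close>, \<open>is_quantization_unique\<close>),
  and \<open>env_topology\<close> is a topology on the whole enveloping algebra (\<open>openin_env_topology\<close>,
  \<open>topspace_env_topology\<close>).
\<close>

lemma free_algebra_simps [simp]:
  "carrier free_algebra = UNIV" "mult free_algebra = (*)" "one free_algebra = 1"
  "zero free_algebra = 0" "add free_algebra = (+)"
  "smult free_algebra = (\<lambda>c f. Poly_Mapping.single 0 c * f)"
  by (simp_all add: free_algebra_def)

lemma ring_free_algebra: "ring (free_algebra :: ('k::comm_ring_1, ('k, 'g) free) module)"
proof (rule ringI)
  show "abelian_group (free_algebra :: ('k, ('k, 'g) free) module)"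
  proof (rule abelian_groupI)
    fix x :: "('k, 'g) free"
    show "\<exists>y\<in>carrier free_algebra. y \<oplus>\<^bsub>free_algebra\<^esub> x = \<zero>\<^bsub>free_algebra\<^esub>"
      by (auto intro: exI[of _ "- x"])
  qed (auto simp: algebra_simps)
  show "Group.monoid (free_algebra :: ('k, ('k, 'g) free) module)"
    by (rule monoidI) (auto simp: algebra_simps)
qed (auto simp: algebra_simps)

lemma a_minus_free_algebra [simp]:
  "f \<ominus>\<^bsub>free_algebra\<^esub> g = f - (g :: ('k::comm_ring_1, 'g) free)"
proof -
  interpret ring "free_algebra :: ('k, ('k, 'g) free) module" by (rule ring_free_algebra)
  have "\<ominus>\<^bsub>free_algebra\<^esub> g = - g" by (rule minus_equality) auto
  then show ?thesis by (simp add: a_minus_def)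
qed

lemma quotient_algebra_simps [simp]:
  "carrier (quotient_algebra A I) = carrier (A Quot I)"
  "mult (quotient_algebra A I) = mult (A Quot I)"
  "one (quotient_algebra A I) = one (A Quot I)"
  "zero (quotient_algebra A I) = zero (A Quot I)"
  "add (quotient_algebra A I) = add (A Quot I)"
  "smult (quotient_algebra A I) = (\<lambda>c X. \<Union>x\<in>X. I +>\<^bsub>A\<^esub> (c \<odot>\<^bsub>A\<^esub> x))"
  by (simp_all add: quotient_algebra_def ring.extend_def module.fields_def)

lemma ring_quotient_algebra:
  assumes "ideal I A" shows "ring (quotient_algebra A I)"
proof -
  interpret Q: ring "A Quot I" using ideal.quotient_is_ring[OF assms] .
  show ?thesis
  proof (rule ringI)
    show "abelian_group (quotient_algebra A I)"
    proof (rule abelian_groupI)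
      fix x assume "x \<in> carrier (quotient_algebra A I)"
      then show "\<exists>y\<in>carrier (quotient_algebra A I).
          y \<oplus>\<^bsub>quotient_algebra A I\<^esub> x = \<zero>\<^bsub>quotient_algebra A I\<^esub>"
        by (intro bexI[of _ "\<ominus>\<^bsub>A Quot I\<^esub> x"]) (simp_all add: Q.l_neg)
    qed (simp_all add: Q.a_ac)
    show "Group.monoid (quotient_algebra A I)"
      by (rule monoidI) (simp_all add: Q.m_assoc)
  qed (simp_all add: Q.l_distr Q.r_distr)
qed

lemma quotient_algebra_hom:
  assumes "ideal I A" shows "(+>\<^bsub>A\<^esub>) I \<in> ring_hom A (quotient_algebra A I)"
  using ideal.rcos_ring_hom[OF assms] by (simp add: ring_hom_def)

locale scalar_algebra = ring A for A :: "('k::comm_ring_1, 'a, 'm) module_scheme" (structure) +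
  assumes smult_closed' [simp]: "x \<in> carrier A \<Longrightarrow> c \<odot> x \<in> carrier A"
    and smult_add: "x \<in> carrier A \<Longrightarrow> y \<in> carrier A \<Longrightarrow> c \<odot> (x \<oplus> y) = c \<odot> x \<oplus> c \<odot> y"
    and smult_mult: "x \<in> carrier A \<Longrightarrow> c \<odot> x = (c \<odot> \<one>) \<otimes> x"
begin

lemma smult_ideal: "ideal I A \<Longrightarrow> x \<in> I \<Longrightarrow> c \<odot> x \<in> I"
  using ideal.I_l_closed[of I A x "c \<odot> \<one>"] ideal.Icarr[of I A x] smult_mult[of x c] by simp

lemma smult_coset:
  assumes I: "ideal I A" and x: "x \<in> carrier A"
  shows "c \<odot>\<^bsub>quotient_algebra A I\<^esub> (I +> x) = I +> (c \<odot> x)"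
proof -
  have sub: "abelian_subgroup I A"
    using ideal.axioms(1)[OF I] abelian_subgroupI3[OF _ is_abelian_group] by blast
  have *: "I +> (c \<odot> y) = I +> (c \<odot> x)" if y: "y \<in> I +> x" for y
  proof -
    from y obtain h where h: "h \<in> I" "y = h \<oplus> x" unfolding a_r_coset_def' by blast
    have hc: "h \<in> carrier A" using ideal.Icarr[OF I h(1)] .
    have "c \<odot> y = c \<odot> h \<oplus> c \<odot> x" unfolding h(2) by (rule smult_add[OF hc x])
    then have "c \<odot> y \<in> I +> (c \<odot> x)"
      unfolding a_r_coset_def' using smult_ideal[OF I h(1)] by blast
    from abelian_subgroup.a_repr_independence'[OF sub this smult_closed'[OF x]] show ?thesis ..
  qed
  have "x \<in> I +> x" using abelian_subgroup.a_rcos_self[OF sub x] .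
  then have "(\<Union>y\<in>I +> x. I +> (c \<odot> y)) = I +> (c \<odot> x)" using * by blast
  then show ?thesis by (simp only: quotient_algebra_simps)
qed

lemma scalar_algebra_quotient:
  assumes "ideal I A" shows "scalar_algebra (quotient_algebra A I)"
proof -
  interpret ideal I A by fact
  interpret Q: ring "quotient_algebra A I" by (rule ring_quotient_algebra) fact
  have carr: "x \<in> carrier (quotient_algebra A I) \<longleftrightarrow> (\<exists>a\<in>carrier A. x = I +> a)" for x
    by (simp add: FactRing_def A_RCOSETS_def' a_r_coset_def)
  note hom = quotient_algebra_hom[OF assms]
  let ?Q = "quotient_algebra A I"
  have sm: "c \<odot>\<^bsub>?Q\<^esub> (I +> x) = I +> (c \<odot> x)" if "x \<in> carrier A" for c x
    using assms that by (rule smult_coset)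
  have cl: "I +> x \<in> carrier ?Q" if "x \<in> carrier A" for x
    using that carr by blast
  have ad: "(I +> x) \<oplus>\<^bsub>?Q\<^esub> (I +> y) = I +> (x \<oplus> y)" if "x \<in> carrier A" "y \<in> carrier A" for x y
    by (rule ring_hom_add[OF hom that, symmetric])
  have mu: "(I +> x) \<otimes>\<^bsub>?Q\<^esub> (I +> y) = I +> (x \<otimes> y)" if "x \<in> carrier A" "y \<in> carrier A" for x y
    by (rule ring_hom_mult[OF hom that, symmetric])
  have on: "\<one>\<^bsub>?Q\<^esub> = I +> \<one>" by (rule ring_hom_one[OF hom, symmetric])
  show ?thesis
  proof
    fix x c assume "x \<in> carrier ?Q"
    then obtain a where a: "a \<in> carrier A" "x = I +> a" using carr by blast
    show "c \<odot>\<^bsub>?Q\<^esub> x \<in> carrier ?Q"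
      unfolding a(2) sm[OF a(1)] by (rule cl) (simp add: a)
    show "c \<odot>\<^bsub>?Q\<^esub> x = (c \<odot>\<^bsub>?Q\<^esub> \<one>\<^bsub>?Q\<^esub>) \<otimes>\<^bsub>?Q\<^esub> x"
      unfolding a(2) on sm[OF a(1)] sm[OF one_closed] mu[OF smult_closed'[OF one_closed] a(1)]
      using arg_cong[OF smult_mult[OF a(1)], of "\<lambda>v. I +> v" c] .
    fix y assume "y \<in> carrier ?Q"
    then obtain b where b: "b \<in> carrier A" "y = I +> b" using carr by blast
    show "c \<odot>\<^bsub>?Q\<^esub> (x \<oplus>\<^bsub>?Q\<^esub> y) = c \<odot>\<^bsub>?Q\<^esub> x \<oplus>\<^bsub>?Q\<^esub> c \<odot>\<^bsub>?Q\<^esub> y"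
      unfolding a(2) b(2) ad[OF a(1) b(1)] sm[OF a(1)] sm[OF b(1)] sm[OF add.m_closed[OF a(1) b(1)]]
        ad[OF smult_closed'[OF a(1)] smult_closed'[OF b(1)]] smult_add[OF a(1) b(1)] ..
  qed
qed

end

lemma scalar_algebra_free: "scalar_algebra (free_algebra :: ('k::comm_ring_1, ('k, 'g) free) module)"
  using ring_free_algebra unfolding scalar_algebra_def scalar_algebra_axioms_def
  by (auto simp: algebra_simps)

lemma ideal_tensor_ideal: "ideal (tensor_ideal scl) free_algebra"
  unfolding tensor_ideal_def by (rule ring.genideal_ideal[OF ring_free_algebra]) simp

lemma scalar_algebra_tensor: "scalar_algebra (tensor_algebra scl)"
  unfolding tensor_algebra_def
  by (rule scalar_algebra.scalar_algebra_quotient[OF scalar_algebra_free ideal_tensor_ideal])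

lemma tensor_class_hom: "tensor_class scl \<in> ring_hom free_algebra (tensor_algebra scl)"
  unfolding tensor_algebra_def tensor_class_def 
  using quotient_algebra_hom[OF ideal_tensor_ideal] .

lemma carrier_tensor: "carrier (tensor_algebra scl) = range (tensor_class scl)"
  unfolding tensor_algebra_def tensor_class_def by (auto simp: FactRing_def A_RCOSETS_def')

lemma tensor_class_smult:
  "c \<odot>\<^bsub>tensor_algebra scl\<^esub> tensor_class scl f = tensor_class scl (Poly_Mapping.single 0 c * f)"
  unfolding tensor_algebra_def tensor_class_def
  by (subst scalar_algebra.smult_coset[OF scalar_algebra_free ideal_tensor_ideal]) auto

lemma tensor_class_eq_iff: "tensor_class scl f = tensor_class scl g \<longleftrightarrow> f - g \<in> tensor_ideal scl"
  unfolding tensor_class_def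
  using ring.quotient_eq_iff_same_a_r_cos[OF ring_free_algebra ideal_tensor_ideal, of f g] by simp

lemma mem_tensor_class: "g \<in> tensor_class scl f \<longleftrightarrow> tensor_class scl g = tensor_class scl f"
proof -
  have "g \<in> tensor_class scl f \<longleftrightarrow> g - f \<in> tensor_ideal scl"
    unfolding tensor_class_def a_r_coset_def' by (auto intro: bexI[of _ "g-f"])
  then show ?thesis by (simp add: tensor_class_eq_iff)
qed

lemma poly_mapping_expand:
  assumes "finite A" "Poly_Mapping.keys f \<subseteq> A"
  shows "(\<Sum>w\<in>A. Poly_Mapping.single w (Poly_Mapping.lookup f w)) = f"
proof (rule poly_mapping_eqI)
  fix k
  have "Poly_Mapping.lookup (\<Sum>w\<in>A. Poly_Mapping.single w (Poly_Mapping.lookup f w)) k =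
      (\<Sum>w\<in>A. if w = k then Poly_Mapping.lookup f k else 0)"
    unfolding lookup_sum by (rule sum.cong) (auto simp: lookup_single when_def)
  also have "\<dots> = Poly_Mapping.lookup f k"
    using assms by (auto simp: sum.delta in_keys_iff)
  finally show "Poly_Mapping.lookup (\<Sum>w\<in>A. Poly_Mapping.single w (Poly_Mapping.lookup f w)) k =
      Poly_Mapping.lookup f k" .
qed

lemma permuted_part_superset:
  assumes "finite A" "Poly_Mapping.keys f \<subseteq> A"
  shows "permuted_part n \<sigma> f = (\<Sum>w\<in>A. if length (letters w) = n then
      Poly_Mapping.single (Word (permute_list \<sigma> (letters w))) (Poly_Mapping.lookup f w) else 0)"
  unfolding permuted_part_def using assms
  by (intro sum.mono_neutral_cong_left) (auto simp: in_keys_iff)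

lemma permuted_part_add: "permuted_part n \<sigma> (f + g) = permuted_part n \<sigma> f + permuted_part n \<sigma> g"
proof -
  let ?A = "Poly_Mapping.keys f \<union> Poly_Mapping.keys g"
  have "finite ?A" by simp
  moreover have "Poly_Mapping.keys (f + g) \<subseteq> ?A" by (rule keys_add)
  ultimately show ?thesis
    by (simp add: permuted_part_superset[of ?A] lookup_add single_add flip: sum.distrib)
      (rule sum.cong, auto simp: lookup_add single_add)
qed

lemma permuted_part_zero [simp]: "permuted_part n \<sigma> 0 = 0"
  by (simp add: permuted_part_def)

lemma permuted_part_uminus: "permuted_part n \<sigma> (- f) = - permuted_part n \<sigma> f"
  using permuted_part_add[of n \<sigma> f "- f"] by (simp add: add_eq_0_iff)

lemma permuted_part_diff: "permuted_part n \<sigma> (f - g) = permuted_part n \<sigma> f - permuted_part n \<sigma> g"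
  using permuted_part_add[of n \<sigma> f "- g"] by (simp add: permuted_part_uminus)

lemma permuted_part_sum: "permuted_part n \<sigma> (\<Sum>i\<in>A. F i) = (\<Sum>i\<in>A. permuted_part n \<sigma> (F i))"
  by (induction A rule: infinite_finite_induct) (simp_all add: permuted_part_add)

lemma permuted_part_single [simp]:
  "permuted_part n \<sigma> (Poly_Mapping.single w c) =
    (if length (letters w) = n then Poly_Mapping.single (Word (permute_list \<sigma> (letters w))) c else 0)"
  using permuted_part_superset[of "{w}" "Poly_Mapping.single w c" n \<sigma>] by simp

lemma permute_middle:
  assumes "\<sigma> permutes {..<length us + 1 + length vs}"
  obtains us' vs' where "\<And>x. permute_list \<sigma> (us @ [x] @ vs) = us' @ [x] @ vs'"
proof -
  let ?n = "length us + 1 + length vs"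
  obtain i where i: "\<sigma> i = length us" "i < ?n"
    using assms by (metis add.commute lessThan_iff less_add_one permutes_def trans_less_add1 add_lessD1 plus_1_eq_Suc)
  define h where "h = (\<lambda>j. (us @ [undefined] @ vs) ! \<sigma> j)"
  have h: "(us @ [x] @ vs) ! \<sigma> j = (if j = i then x else h j)" for x j
  proof (cases "j = i")
    case False
    then have "\<sigma> j \<noteq> length us" using i assms by (metis permutes_inverses(2))
    then show ?thesis using False by (auto simp: h_def nth_append nth_Cons')
  qed (simp add: i)
  have "permute_list \<sigma> (us @ [x] @ vs) = map h [0..<i] @ [x] @ map h [Suc i..<?n]" for x
  proof -
    have "permute_list \<sigma> (us @ [x] @ vs) = map (\<lambda>j. if j = i then x else h j) [0..<?n]"
      by (simp only: permute_list_def h) simp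
    also
    have "[0..<?n] = [0..<i] @ [i] @ [Suc i..<?n]"
      using i(2) by (metis append_Cons append_Nil le_add1 less_imp_le_nat upt_add_eq_append upt_conv_Cons le_add_diff_inverse plus_nat.add_0)
    finally show ?thesis by (simp del: upt_Suc)
  qed
  then show ?thesis using that by blast
qed

lemma permuted_part_tensor_ideal:
  fixes scl :: "'k::comm_ring_1 \<Rightarrow> 'g::ab_group_add \<Rightarrow> 'g"
  assumes f: "f \<in> tensor_ideal scl" and \<sigma>: "\<sigma> permutes {..<n}"
  shows "permuted_part n \<sigma> f \<in> tensor_ideal scl"
proof -
  interpret I: ideal "tensor_ideal scl" free_algebra by (rule ideal_tensor_ideal)
  let ?I = "tensor_ideal scl"
  have Il: "a * b \<in> ?I" if "b \<in> ?I" for a b using I.I_l_closed[OF that] by simp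
  have Ir: "b * a \<in> ?I" if "b \<in> ?I" for a b using I.I_r_closed[OF that] by simp
  have I0: "0 \<in> ?I" using additive_subgroup.zero_closed[OF I.is_additive_subgroup] by simp
  have Ia: "a + b \<in> ?I" if "a \<in> ?I" "b \<in> ?I" for a b using additive_subgroup.a_closed[OF I.is_additive_subgroup that] by simp
  have Im: "- a \<in> ?I" if "a \<in> ?I" for a using Il[OF that, of "-1"] by simp
  have Is: "(\<Sum>i\<in>A. F i) \<in> ?I" if "\<And>i. i \<in> A \<Longrightarrow> F i \<in> ?I" for A and F :: "'x \<Rightarrow> _"
    using that by (induction A rule: infinite_finite_induct) (auto intro: I0 Ia)
  have rel: "linear_relations scl \<subseteq> ?I"
    unfolding tensor_ideal_def by (rule ring.genideal_self[OF ring_free_algebra]) simp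
  let ?s = "Poly_Mapping.single :: 'g fword \<Rightarrow> 'k \<Rightarrow> _"
  define J where "J = {f. \<forall>u v c d. permuted_part n \<sigma> (?s u c * f * ?s v d) \<in> ?I}"
  have J0: "0 \<in> J" by (simp add: J_def I0)
  have Ja: "a + b \<in> J" if "a \<in> J" "b \<in> J" for a b
    using that by (auto simp: J_def algebra_simps permuted_part_add intro: Ia)
  have Jm: "- a \<in> J" if "a \<in> J" for a
    using that by (auto simp: J_def permuted_part_uminus intro: Im)
  have Jl: "a * f \<in> J" if "f \<in> J" for a f
  proof -
    have "permuted_part n \<sigma> (?s u c * (a * f) * ?s v d) \<in> ?I" for u v c d
    proof -
      have "?s u c * (a * f) * ?s v d =
          (\<Sum>w\<in>Poly_Mapping.keys a. ?s (u + w) (c * Poly_Mapping.lookup a w) * f * ?s v d)"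
        by (subst poly_mapping_expand[of "Poly_Mapping.keys a" a, symmetric])
          (simp_all add: sum_distrib_left sum_distrib_right mult.assoc flip: mult_single)
      then show ?thesis using that by (auto simp: permuted_part_sum J_def intro!: Is)
    qed
    then show ?thesis by (simp add: J_def)
  qed
  have Jr: "f * a \<in> J" if "f \<in> J" for a f
  proof -
    have "permuted_part n \<sigma> (?s u c * (f * a) * ?s v d) \<in> ?I" for u v c d
    proof -
      have "?s u c * (f * a) * ?s v d =
          (\<Sum>w\<in>Poly_Mapping.keys a. ?s u c * f * ?s (w + v) (Poly_Mapping.lookup a w * d))"
        by (subst poly_mapping_expand[of "Poly_Mapping.keys a" a, symmetric])
          (simp_all add: sum_distrib_left sum_distrib_right mult.assoc flip: mult_single)
      then show ?thesis using that by (auto simp: permuted_part_sum J_def intro!: Is)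
    qed
    then show ?thesis by (simp add: J_def)
  qed
  have idJ: "ideal J free_algebra"
  proof (rule idealI[OF ring_free_algebra])
    show "subgroup J (add_monoid (free_algebra :: ('k, ('k, 'g) free) module))"
    proof (rule group.subgroupI)
      show "Group.group (add_monoid (free_algebra :: ('k, ('k, 'g) free) module))"
        using abelian_group.a_group[OF ring.is_abelian_group[OF ring_free_algebra]] .
      show "inv\<^bsub>add_monoid free_algebra\<^esub> a \<in> J" if "a \<in> J" for a
        using Jm[OF that] a_minus_free_algebra[of 0 a]
        by (simp add: a_minus_def a_inv_def)
    qed (use J0 Ja in auto)
  qed (simp_all add: Jl Jr)
  have pp: "\<exists>a b. \<forall>x e. permuted_part n \<sigma> (?s u c * ?s (Word [x]) e * ?s v d) = a * ?s (Word [x]) e * b" for u v c d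
  proof (cases "length (letters u) + 1 + length (letters v) = n")
    case True
    obtain us vs where "\<And>x. permute_list \<sigma> (letters u @ [x] @ letters v) = us @ [x] @ vs"
      using permute_middle[of \<sigma> "letters u" "letters v"] \<sigma> True by metis
    then have "\<forall>x e. permuted_part n \<sigma> (?s u c * ?s (Word [x]) e * ?s v d) = ?s (Word us) c * ?s (Word [x]) e * ?s (Word vs) d"
      using True by (simp add: mult_single plus_fword_def)
    then show ?thesis by blast
  next
    case False
    then have "\<forall>x e. permuted_part n \<sigma> (?s u c * ?s (Word [x]) e * ?s v d) = 0 * ?s (Word [x]) e * 0"
      by (simp add: mult_single plus_fword_def)
    then show ?thesis by blast
  qed
  have "linear_relations scl \<subseteq> J"
  proof
    fix r assume r: "r \<in> linear_relations scl"
    have "permuted_part n \<sigma> (?s u c * r * ?s v d) \<in> ?I" for u v c d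
    proof -
      obtain a b where ab: "\<And>x e. permuted_part n \<sigma> (?s u c * ?s (Word [x]) e * ?s v d) = a * ?s (Word [x]) e * b"
        using pp by metis
      have "permuted_part n \<sigma> (?s u c * r * ?s v d) = a * r * b"
      proof -
        have gen: "?s 0 e * gen x = ?s (Word [x]) e" for e x
          by (simp add: mult_single)
        from r consider x y where "r = gen (x + y) - (gen x + gen y)"
          | e x where "r = gen (scl e x) - ?s (Word [x]) e"
          unfolding linear_relations_def gen by blast
        then show ?thesis
          by cases (simp_all only: ab right_diff_distrib left_diff_distrib distrib_left distrib_right
              permuted_part_diff permuted_part_add)
      qed
      then show ?thesis using r rel by (auto intro: Il Ir)
    qed
    then show "r \<in> J" by (simp add: J_def)
  qed
  then have "?I \<subseteq> J" unfolding tensor_ideal_def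
    by (rule ring.genideal_minimal[OF ring_free_algebra idJ])
  with f have "f \<in> J" by blast
  then have "permuted_part n \<sigma> (?s 0 1 * f * ?s 0 1) \<in> ?I" unfolding J_def by blast
  then show ?thesis by simp
qed

lemma permuted_component_class:
  assumes "\<sigma> permutes {..<n}"
  shows "permuted_component scl n \<sigma> (tensor_class scl f) = tensor_class scl (permuted_part n \<sigma> f)"
proof -
  have "tensor_class scl (permuted_part n \<sigma> g) = tensor_class scl (permuted_part n \<sigma> f)"
    if "g \<in> tensor_class scl f" for g
  proof -
    have "g - f \<in> tensor_ideal scl" using that by (simp add: mem_tensor_class tensor_class_eq_iff)
    from permuted_part_tensor_ideal[OF this assms] show ?thesis
      by (simp add: permuted_part_diff tensor_class_eq_iff)
  qed
  moreover have "f \<in> tensor_class scl f" by (simp add: mem_tensor_class)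
  ultimately show ?thesis unfolding permuted_component_def by blast
qed

lemma permuted_part_smult:
  "permuted_part n \<sigma> (Poly_Mapping.single 0 c * f) = Poly_Mapping.single 0 c * permuted_part n \<sigma> f"
proof -
  let ?K = "Poly_Mapping.keys f"
  have "Poly_Mapping.single 0 c * f =
      (\<Sum>w\<in>?K. Poly_Mapping.single w (c * Poly_Mapping.lookup f w))"
    by (subst poly_mapping_expand[of ?K f, symmetric]) (simp_all add: sum_distrib_left mult_single)
  then show ?thesis
    by (simp add: permuted_part_sum permuted_part_superset[of ?K f] sum_distrib_left mult_single if_distrib
        cong: if_cong)
qed

lemma tensor_class_mem_symmetric_iff:
  "tensor_class scl f \<in> symmetric_tensors scl \<longleftrightarrow>
    (\<forall>n \<sigma>. \<sigma> permutes {..<n} \<longrightarrow> permuted_part n \<sigma> f - permuted_part n id f \<in> tensor_ideal scl)"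
  by (auto simp: symmetric_tensors_def component_def permuted_component_class permutes_id
      tensor_class_eq_iff carrier_tensor)

definition sym_word :: "'g list \<Rightarrow> ('k::field_char_0, 'g) free"
  where "sym_word xs = Poly_Mapping.single 0 (inverse (fact (length xs))) *
    (\<Sum>\<sigma>\<in>{\<sigma>. \<sigma> permutes {..<length xs}}. Poly_Mapping.single (Word (permute_list \<sigma> xs)) 1)"

lemma symmetrized_product_hom:
  fixes h :: "('k::field_char_0, 'g) free \<Rightarrow> 'a" and A :: "('k, 'a, 'm) module_scheme"
  assumes A: "ring A" and h: "h \<in> ring_hom free_algebra A"
    and sm: "\<And>c f. h (Poly_Mapping.single 0 c * f) = c \<odot>\<^bsub>A\<^esub> h f"
  shows "symmetrized_product A (map (\<lambda>x. h (gen x)) xs) = h (sym_word xs)"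
proof -
  interpret H: ring_hom_ring free_algebra A h
    using ring_hom_ringI2[OF ring_free_algebra A h] .
  have lp: "list_product A (map (\<lambda>x. h (gen x)) ys) = h (Poly_Mapping.single (Word ys) 1)" for ys
  proof (induction ys)
    case Nil
    have "Poly_Mapping.single (Word []) 1 = (1 :: ('k, 'g) free)"
      by (simp add: single_one[symmetric] zero_fword_def del: single_one)
    then show ?case using H.hom_one by (simp add: list_product_def)
  next
    case (Cons y ys)
    have "Poly_Mapping.single (Word (y # ys)) 1 = gen y * Poly_Mapping.single (Word ys) (1::'k)"
      by (simp add: mult_single plus_fword_def)
    then show ?case using Cons ring_hom_mult[OF h, of "gen y" "Poly_Mapping.single (Word ys) 1"]
      by (simp add: list_product_def)
  qed
  let ?P = "{\<sigma>. \<sigma> permutes {..<length xs}}"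
  have fs: "finsum A (\<lambda>\<sigma>. h (F \<sigma>)) P = h (\<Sum>\<sigma>\<in>P. F \<sigma>)" for F :: "(nat \<Rightarrow> nat) \<Rightarrow> _" and P
  proof (induction P rule: infinite_finite_induct)
    case (insert x P)
    then show ?case using ring_hom_add[OF h, of "F x" "\<Sum>\<sigma>\<in>P. F \<sigma>"] H.hom_closed by simp
  qed (use H.hom_zero in simp_all)
  have "(\<Oplus>\<^bsub>A\<^esub>\<sigma>\<in>?P. list_product A (permute_list \<sigma> (map (\<lambda>x. h (gen x)) xs))) =
      (\<Oplus>\<^bsub>A\<^esub>\<sigma>\<in>?P. h (Poly_Mapping.single (Word (permute_list \<sigma> xs)) 1))"
    by (rule H.S.finsum_cong') (use H.hom_closed in \<open>auto simp: permute_list_map lp\<close>)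
  also have "\<dots> = h (\<Sum>\<sigma>\<in>?P. Poly_Mapping.single (Word (permute_list \<sigma> xs)) 1)" by (rule fs)
  finally show ?thesis by (simp add: symmetrized_product_def sym_word_def sm)
qed

lemma symmetric_product_eq: "symmetric_product scl xs = tensor_class scl (sym_word xs)"
proof -
  interpret scalar_algebra "tensor_algebra scl" by (rule scalar_algebra_tensor)
  show ?thesis
    using symmetrized_product_hom[OF ring_axioms tensor_class_hom tensor_class_smult[symmetric]]
    by (simp add: symmetric_product_def tensor_incl_def[abs_def])
qed

lemma symmetric_product_mem:
  fixes scl :: "'k::field_char_0 \<Rightarrow> 'g::ab_group_add \<Rightarrow> 'g"
  shows "symmetric_product scl xs \<in> symmetric_tensors scl"
proof -
  have "permuted_part n \<sigma> (sym_word xs) = (permuted_part n id (sym_word xs) :: ('k, 'g) free)"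
    if "\<sigma> permutes {..<n}" for n \<sigma>
  proof (cases "length xs = n")
    case True
    let ?P = "{\<tau>. \<tau> permutes {..<n}}" and ?s = "\<lambda>ys. Poly_Mapping.single (Word ys) (1::'k)"
    have id: "permute_list \<sigma> (permute_list \<tau> xs) = permute_list (\<tau> \<circ> \<sigma>) xs" for \<tau>
      using permute_list_compose[of \<sigma> xs \<tau>] that True by simp
    have "(\<Sum>\<tau>\<in>?P. ?s (permute_list \<sigma> (permute_list \<tau> xs))) = (\<Sum>\<tau>\<in>?P. ?s (permute_list \<tau> xs))"
      unfolding id by (rule sum_permutations_compose_right[OF that, symmetric])
    moreover have "permuted_part n \<rho> (sym_word xs :: ('k, 'g) free) =
        Poly_Mapping.single 0 (inverse (fact n)) * (\<Sum>\<tau>\<in>?P. ?s (permute_list \<rho> (permute_list \<tau> xs)))" for \<rho>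
      by (simp add: sym_word_def permuted_part_smult permuted_part_sum True)
    ultimately show ?thesis by (simp only: permute_list_id)
  qed (simp add: sym_word_def permuted_part_smult permuted_part_sum)
  then have "permuted_part n \<sigma> (sym_word xs) - permuted_part n id (sym_word xs) = (0 :: ('k, 'g) free)"
    if "\<sigma> permutes {..<n}" for n \<sigma> using that by (metis diff_self)
  moreover have "0 \<in> tensor_ideal scl"
    using additive_subgroup.zero_closed[OF ideal.axioms(1)[OF ideal_tensor_ideal, of scl]] by simp
  ultimately show ?thesis
    unfolding symmetric_product_eq tensor_class_mem_symmetric_iff by metis
qed

lemma symmetric_tensor_expand:
  fixes scl :: "'k::field_char_0 \<Rightarrow> 'g::ab_group_add \<Rightarrow> 'g"
  assumes "tensor_class scl f \<in> symmetric_tensors scl"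
  shows "tensor_class scl f = tensor_class scl
    (\<Sum>w\<in>Poly_Mapping.keys f. Poly_Mapping.single 0 (Poly_Mapping.lookup f w) * sym_word (letters w))"
proof -
  let ?I = "tensor_ideal scl" and ?K = "Poly_Mapping.keys f"
  interpret I: ideal ?I free_algebra by (rule ideal_tensor_ideal)
  have Il: "a * b \<in> ?I" if "b \<in> ?I" for a b using I.I_l_closed[OF that] by simp
  have I0: "0 \<in> ?I" using additive_subgroup.zero_closed[OF I.is_additive_subgroup] by simp
  have Ia: "a + b \<in> ?I" if "a \<in> ?I" "b \<in> ?I" for a b
    using additive_subgroup.a_closed[OF I.is_additive_subgroup that] by simp
  have Is: "(\<Sum>i\<in>A. F i) \<in> ?I" if "\<And>i. i \<in> A \<Longrightarrow> F i \<in> ?I" for A and F :: "'x \<Rightarrow> _"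
    using that by (induction A rule: infinite_finite_induct) (auto intro: I0 Ia)
  let ?P = "\<lambda>n::nat. {\<sigma>. \<sigma> permutes {..<n}}"
  let ?c = "\<lambda>n. Poly_Mapping.single 0 (inverse (fact n)) :: ('k, 'g) free"
  have diff: "permuted_part n id f - ?c n * (\<Sum>\<sigma>\<in>?P n. permuted_part n \<sigma> f) \<in> ?I" for n
  proof -
    have "?c n * of_nat (fact n) = 1"
      by (simp add: of_nat_single mult_single flip: single_of_nat)
    moreover have "(\<Sum>\<sigma>\<in>?P n. permuted_part n id f) = of_nat (fact n) * permuted_part n id f"
      by (simp add: card_permutations)
    ultimately have "permuted_part n id f = ?c n * (\<Sum>\<sigma>\<in>?P n. permuted_part n id f)"
      by (simp add: mult.assoc[symmetric])
    then have "permuted_part n id f - ?c n * (\<Sum>\<sigma>\<in>?P n. permuted_part n \<sigma> f) =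
        - ?c n * (\<Sum>\<sigma>\<in>?P n. permuted_part n \<sigma> f - permuted_part n id f)"
      by (simp add: sum_subtractf algebra_simps)
    also have "\<dots> \<in> ?I"
      using assms by (intro Il Is) (auto simp: tensor_class_mem_symmetric_iff)
    finally show ?thesis .
  qed
  let ?L = "(\<lambda>w. length (letters w)) ` ?K"
  have 1: "(\<Sum>n\<in>?L. permuted_part n id f) = f"
  proof -
    have "(\<Sum>n\<in>?L. permuted_part n id f) =
        (\<Sum>n\<in>?L. \<Sum>w\<in>?K. if length (letters w) = n then Poly_Mapping.single w (Poly_Mapping.lookup f w) else 0)"
      by (simp add: permuted_part_superset[of ?K f] cong: if_cong)
    also have "\<dots> = (\<Sum>w\<in>?K. \<Sum>n\<in>?L. if length (letters w) = n then Poly_Mapping.single w (Poly_Mapping.lookup f w) else 0)"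
      by (rule sum.swap)
    also have "\<dots> = (\<Sum>w\<in>?K. Poly_Mapping.single w (Poly_Mapping.lookup f w))"
      by (rule sum.cong) simp_all
    finally show ?thesis by (simp add: poly_mapping_expand)
  qed
  have 2: "(\<Sum>n\<in>?L. ?c n * (\<Sum>\<sigma>\<in>?P n. permuted_part n \<sigma> f)) =
      (\<Sum>w\<in>?K. Poly_Mapping.single 0 (Poly_Mapping.lookup f w) * sym_word (letters w))"
  proof -
    have "(\<Sum>n\<in>?L. ?c n * (\<Sum>\<sigma>\<in>?P n. permuted_part n \<sigma> f)) =
        (\<Sum>n\<in>?L. \<Sum>w\<in>?K. if length (letters w) = n
          then Poly_Mapping.single 0 (Poly_Mapping.lookup f w) * sym_word (letters w) else 0)"
    proof (rule sum.cong)
      fix n assume "n \<in> ?L"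
      have "?c n * (\<Sum>\<sigma>\<in>?P n. permuted_part n \<sigma> f) =
          (\<Sum>\<sigma>\<in>?P n. \<Sum>w\<in>?K. if length (letters w) = n then
             Poly_Mapping.single (Word (permute_list \<sigma> (letters w))) (inverse (fact n) * Poly_Mapping.lookup f w) else 0)"
        by (simp add: permuted_part_superset[of ?K f] sum_distrib_left mult_single if_distrib cong: if_cong)
      also have "\<dots> = (\<Sum>w\<in>?K. \<Sum>\<sigma>\<in>?P n. if length (letters w) = n then
             Poly_Mapping.single (Word (permute_list \<sigma> (letters w))) (inverse (fact n) * Poly_Mapping.lookup f w) else 0)"
        by (rule sum.swap)
      also have "\<dots> = (\<Sum>w\<in>?K. if length (letters w) = n
          then Poly_Mapping.single 0 (Poly_Mapping.lookup f w) * sym_word (letters w) else 0)"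
        by (rule sum.cong) (auto simp: sym_word_def sum_distrib_left mult_single mult.commute)
      finally show "?c n * (\<Sum>\<sigma>\<in>?P n. permuted_part n \<sigma> f) = (\<Sum>w\<in>?K. if length (letters w) = n
          then Poly_Mapping.single 0 (Poly_Mapping.lookup f w) * sym_word (letters w) else 0)" .
    qed simp
    also have "\<dots> = (\<Sum>w\<in>?K. \<Sum>n\<in>?L. if length (letters w) = n
          then Poly_Mapping.single 0 (Poly_Mapping.lookup f w) * sym_word (letters w) else 0)"
      by (rule sum.swap)
    also have "\<dots> = (\<Sum>w\<in>?K. Poly_Mapping.single 0 (Poly_Mapping.lookup f w) * sym_word (letters w))"
      by (rule sum.cong) simp_all
    finally show ?thesis .
  qed
  have "(\<Sum>n\<in>?L. permuted_part n id f - ?c n * (\<Sum>\<sigma>\<in>?P n. permuted_part n \<sigma> f)) \<in> ?I"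
    by (rule Is) (rule diff)
  then show ?thesis unfolding tensor_class_eq_iff sum_subtractf 1 2 .
qed

lemma ideal_env_ideal: "ideal (env_ideal scl bracket z) (tensor_algebra scl)"
proof -
  interpret scalar_algebra "tensor_algebra scl" by (rule scalar_algebra_tensor)
  have incl: "tensor_incl scl x \<in> carrier (tensor_algebra scl)" for x
    by (auto simp: carrier_tensor tensor_incl_def)
  have "env_relations scl bracket z \<subseteq> carrier (tensor_algebra scl)"
    unfolding env_relations_def
    by clarify (intro minus_closed m_closed smult_closed' incl)
  then show ?thesis unfolding env_ideal_def by (rule genideal_ideal)
qed

lemma scalar_algebra_env: "scalar_algebra (env_algebra scl bracket z)"
  unfolding env_algebra_def
  by (rule scalar_algebra.scalar_algebra_quotient[OF scalar_algebra_tensor ideal_env_ideal])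

lemma symmetric_tensors_closed:
  assumes "s \<in> symmetric_tensors scl"
  shows "c \<odot>\<^bsub>tensor_algebra scl\<^esub> s \<in> symmetric_tensors scl"
    and "t \<in> symmetric_tensors scl \<Longrightarrow> s \<oplus>\<^bsub>tensor_algebra scl\<^esub> t \<in> symmetric_tensors scl"
proof -
  interpret I: ideal "tensor_ideal scl" free_algebra by (rule ideal_tensor_ideal)
  have cl: "symmetric_tensors scl \<subseteq> range (tensor_class scl)"
    by (auto simp: symmetric_tensors_def carrier_tensor)
  then obtain f where f: "s = tensor_class scl f" using assms by blast
  note f' = assms[unfolded f tensor_class_mem_symmetric_iff]
  have "Poly_Mapping.single 0 c * permuted_part n \<sigma> f - Poly_Mapping.single 0 c * permuted_part n id f
      \<in> tensor_ideal scl" if "\<sigma> permutes {..<n}" for n \<sigma>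
    using I.I_l_closed[of "permuted_part n \<sigma> f - permuted_part n id f" "Poly_Mapping.single 0 c"] f' that
    by (simp add: right_diff_distrib)
  then show "c \<odot>\<^bsub>tensor_algebra scl\<^esub> s \<in> symmetric_tensors scl"
    by (simp add: f tensor_class_smult tensor_class_mem_symmetric_iff permuted_part_smult)
  assume t: "t \<in> symmetric_tensors scl"
  then obtain g where g: "t = tensor_class scl g" using cl by blast
  note g' = t[unfolded g tensor_class_mem_symmetric_iff]
  have "permuted_part n \<sigma> f + permuted_part n \<sigma> g - (permuted_part n id f + permuted_part n id g)
      \<in> tensor_ideal scl" if "\<sigma> permutes {..<n}" for n \<sigma>
    using additive_subgroup.a_closed[OF I.is_additive_subgroup, of
        "permuted_part n \<sigma> f - permuted_part n id f" "permuted_part n \<sigma> g - permuted_part n id g"] f' g' that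
    by (simp add: algebra_simps)
  moreover have "s \<oplus>\<^bsub>tensor_algebra scl\<^esub> t = tensor_class scl (f + g)"
    unfolding f g using ring_hom_add[OF tensor_class_hom, of f g scl] by simp
  ultimately show "s \<oplus>\<^bsub>tensor_algebra scl\<^esub> t \<in> symmetric_tensors scl"
    by (simp add: tensor_class_mem_symmetric_iff permuted_part_add)
qed

lemma is_quantization_projection:
  fixes scl :: "'k::field_char_0 \<Rightarrow> 'g::ab_group_add \<Rightarrow> 'g"
  shows "is_quantization scl bracket z
    (restrict (\<lambda>t. env_ideal scl bracket z +>\<^bsub>tensor_algebra scl\<^esub> t) (symmetric_tensors scl))"
    (is "is_quantization _ _ _ (restrict ?e ?S)")
proof -
  let ?T = "tensor_algebra scl" and ?U = "env_algebra scl bracket z"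
  interpret T: scalar_algebra ?T by (rule scalar_algebra_tensor)
  interpret U: scalar_algebra ?U by (rule scalar_algebra_env)
  have hom: "?e \<in> ring_hom ?T ?U"
    unfolding env_algebra_def by (rule quotient_algebra_hom[OF ideal_env_ideal])
  have S: "s \<in> carrier ?T" if "s \<in> ?S" for s using that by (simp add: symmetric_tensors_def)
  have sm: "?e (c \<odot>\<^bsub>?T\<^esub> t) = c \<odot>\<^bsub>?U\<^esub> ?e t" if "t \<in> carrier ?T" for c t
    using T.smult_coset[OF ideal_env_ideal that] by (simp add: env_algebra_def)
  have hom': "(\<lambda>f. ?e (tensor_class scl f)) \<in> ring_hom free_algebra ?U"
    using ring_hom_trans[OF tensor_class_hom hom] unfolding comp_def .
  have tc: "tensor_class scl f \<in> carrier ?T" for f by (simp add: carrier_tensor)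
  have sym: "?e (symmetric_product scl xs) = symmetrized_product ?U (map (env_incl scl bracket z) xs)" for xs
  proof -
    have "symmetrized_product ?U (map (\<lambda>x. ?e (tensor_class scl (gen x))) xs) = ?e (tensor_class scl (sym_word xs))"
      by (rule symmetrized_product_hom[OF U.ring_axioms hom'])
        (simp only: sm[OF tc] tensor_class_smult[symmetric])
    then show ?thesis
      unfolding symmetric_product_eq env_incl_def[abs_def] tensor_incl_def ..
  qed
  show ?thesis
    unfolding is_quantization_def Let_def
  proof (intro conjI ballI allI)
    show "restrict ?e ?S \<in> ?S \<rightarrow>\<^sub>E carrier ?U"
      using ring_hom_closed[OF hom S] by (intro restrict_PiE_iff[THEN iffD2] ballI)
  next
    fix s t assume st: "s \<in> ?S" "t \<in> ?S"
    show "restrict ?e ?S (s \<oplus>\<^bsub>?T\<^esub> t) = restrict ?e ?S s \<oplus>\<^bsub>?U\<^esub> restrict ?e ?S t"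
      unfolding restrict_apply'[OF st(1)] restrict_apply'[OF st(2)]
        restrict_apply'[OF symmetric_tensors_closed(2)[OF st]]
      by (rule ring_hom_add[OF hom S[OF st(1)] S[OF st(2)]])
  next
    fix c s assume s: "s \<in> ?S"
    show "restrict ?e ?S (c \<odot>\<^bsub>?T\<^esub> s) = c \<odot>\<^bsub>?U\<^esub> restrict ?e ?S s"
      unfolding restrict_apply'[OF s] restrict_apply'[OF symmetric_tensors_closed(1)[OF s]]
      by (rule sm[OF S[OF s]])
  next
    fix xs
    show "restrict ?e ?S (symmetric_product scl xs) =
        symmetrized_product ?U (map (env_incl scl bracket z) xs)"
      unfolding restrict_apply'[OF symmetric_product_mem] by (rule sym)
  qed
qed

lemma is_quantization_unique:
  fixes scl :: "'k::field_char_0 \<Rightarrow> 'g::ab_group_add \<Rightarrow> 'g"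
  assumes q: "is_quantization scl bracket z q" and r: "is_quantization scl bracket z r"
  shows "q = r"
proof -
  let ?T = "tensor_algebra scl" and ?S = "symmetric_tensors scl"
  note q = q[unfolded is_quantization_def Let_def] and r = r[unfolded is_quantization_def Let_def]
  have smul: "c \<odot>\<^bsub>?T\<^esub> s \<in> ?S \<and> q (c \<odot>\<^bsub>?T\<^esub> s) = r (c \<odot>\<^bsub>?T\<^esub> s)"
    if "s \<in> ?S" "q s = r s" for c s
    using q r that symmetric_tensors_closed(1) by metis
  have sp: "q (symmetric_product scl xs) = r (symmetric_product scl xs)" for xs
    using q r by metis
  have trm: "tensor_class scl (Poly_Mapping.single 0 c * sym_word xs) \<in> ?S \<and>
      q (tensor_class scl (Poly_Mapping.single 0 c * sym_word xs)) =
      r (tensor_class scl (Poly_Mapping.single 0 c * sym_word xs))" for c xs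
    using smul[OF symmetric_product_mem sp, of c xs]
    unfolding symmetric_product_eq tensor_class_smult .
  have fin: "tensor_class scl (\<Sum>w\<in>A. Poly_Mapping.single 0 (F w) * sym_word (letters w)) \<in> ?S \<and>
      q (tensor_class scl (\<Sum>w\<in>A. Poly_Mapping.single 0 (F w) * sym_word (letters w))) =
      r (tensor_class scl (\<Sum>w\<in>A. Poly_Mapping.single 0 (F w) * sym_word (letters w)))"
    if "finite A" for A and F :: "'g fword \<Rightarrow> 'k"
    using that
  proof induction
    case empty
    then show ?case using trm[of 0 "[]"] by simp
  next
    case (insert w A)
    have add: "tensor_class scl (f + g) = tensor_class scl f \<oplus>\<^bsub>?T\<^esub> tensor_class scl g" for f g
      using ring_hom_add[OF tensor_class_hom, of f g scl] by simp
    have "s \<oplus>\<^bsub>?T\<^esub> t \<in> ?S \<and> q (s \<oplus>\<^bsub>?T\<^esub> t) = r (s \<oplus>\<^bsub>?T\<^esub> t)"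
      if "s \<in> ?S \<and> q s = r s" "t \<in> ?S \<and> q t = r t" for s t
      using q r that symmetric_tensors_closed(2) by metis
    from this[OF trm insert.IH] show ?case
      unfolding sum.insert[OF insert.hyps] add .
  qed
  have "q t = r t" if t: "t \<in> ?S" for t
  proof -
    obtain f where f: "t = tensor_class scl f"
      using t by (auto simp: symmetric_tensors_def carrier_tensor)
    show ?thesis
      using fin[OF finite_keys[of f], of "Poly_Mapping.lookup f"] symmetric_tensor_expand[of scl f] t
      unfolding f by metis
  qed
  then show ?thesis
    using q r by (intro extensionalityI[of q ?S r]) (simp_all add: PiE_def)
qed

lemma is_quantization_quantization: "is_quantization scl bracket z (quantization scl bracket z)"
  unfolding quantization_def
  by (rule theI[of _ "restrict _ _"])
    (rule is_quantization_projection, rule is_quantization_unique[OF _ is_quantization_projection])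

lemma quantization_eq_projection:
  "t \<in> symmetric_tensors scl \<Longrightarrow>
    quantization scl bracket z t = env_ideal scl bracket z +>\<^bsub>tensor_algebra scl\<^esub> t"
  unfolding is_quantization_unique[OF is_quantization_quantization is_quantization_projection]
  by (rule restrict_apply')

lemma topspace_symmetric_topology [simp]:
  "topspace (symmetric_topology scl R) = symmetric_tensors scl"
proof -
  have "t \<in> topspace (symmetric_topology scl R)" if t: "t \<in> symmetric_tensors scl" for t
  proof -
    let ?r = "tensor_seminorm scl R (\<lambda>_. 0) (t \<ominus>\<^bsub>tensor_algebra scl\<^esub> t)"
    have "continuous_seminorm scl (\<lambda>_. 0)"
      by (simp add: continuous_seminorm_def seminorm_def)
    moreover have "\<bar>?r\<bar> + 1 > 0" "?r < \<bar>?r\<bar> + 1" by auto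
    ultimately show ?thesis
      unfolding symmetric_topology_def topology_generated_by_topspace using t by blast
  qed
  then show ?thesis
    unfolding symmetric_topology_def topology_generated_by_topspace by blast
qed

lemma openin_env_topology:
  "openin (env_topology scl bracket R z) V \<longleftrightarrow>
    V \<subseteq> carrier (env_algebra scl bracket z) \<and>
    openin (symmetric_topology scl R)
      {s \<in> symmetric_tensors scl. quantization scl bracket z s \<in> V}"
proof -
  let ?X = "symmetric_topology scl R" and ?q = "quantization scl bracket z"
    and ?S = "symmetric_tensors scl" and ?U = "carrier (env_algebra scl bracket z)"
  have "istopology (\<lambda>V. V \<subseteq> ?U \<and> openin ?X {s \<in> ?S. ?q s \<in> V})"
    unfolding istopology_def
  proof (intro conjI allI impI)
    fix V W assume "V \<subseteq> ?U \<and> openin ?X {s \<in> ?S. ?q s \<in> V}" "W \<subseteq> ?U \<and> openin ?X {s \<in> ?S. ?q s \<in> W}"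
    moreover have "{s \<in> ?S. ?q s \<in> V \<inter> W} = {s \<in> ?S. ?q s \<in> V} \<inter> {s \<in> ?S. ?q s \<in> W}" by auto
    ultimately show "V \<inter> W \<subseteq> ?U" "openin ?X {s \<in> ?S. ?q s \<in> V \<inter> W}" by auto
  next
    fix \<K> assume K: "\<forall>V\<in>\<K>. V \<subseteq> ?U \<and> openin ?X {s \<in> ?S. ?q s \<in> V}"
    have "{s \<in> ?S. ?q s \<in> \<Union>\<K>} = (\<Union>V\<in>\<K>. {s \<in> ?S. ?q s \<in> V})" by auto
    with K show "\<Union>\<K> \<subseteq> ?U" "openin ?X {s \<in> ?S. ?q s \<in> \<Union>\<K>}" by auto
  qed
  then show ?thesis by (simp add: env_topology_def topology_inverse')
qed

lemma topspace_env_topology [simp]: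
  "topspace (env_topology scl bracket R z) = carrier (env_algebra scl bracket z)"
proof
  show "topspace (env_topology scl bracket R z) \<subseteq> carrier (env_algebra scl bracket z)"
    using openin_env_topology by (metis openin_topspace)
  have "quantization scl bracket z \<in> symmetric_tensors scl \<rightarrow>\<^sub>E carrier (env_algebra scl bracket z)"
    using is_quantization_quantization[of scl bracket z] unfolding is_quantization_def Let_def by blast
  then have "{s \<in> symmetric_tensors scl. quantization scl bracket z s \<in> carrier (env_algebra scl bracket z)}
      = topspace (symmetric_topology scl R)" by (auto simp del: quotient_algebra_simps)
  then have "openin (env_topology scl bracket R z) (carrier (env_algebra scl bracket z))"
    unfolding openin_env_topology by (simp only: openin_topspace order_refl)
  then show "carrier (env_algebra scl bracket z) \<subseteq> topspace (env_topology scl bracket R z)"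
    by (rule openin_subset)
qed

lemma homeomorphic_map_quantization:
  assumes "bij_betw (quantization scl bracket z) (symmetric_tensors scl) (carrier (env_algebra scl bracket z))"
  shows "homeomorphic_map (symmetric_topology scl R) (env_topology scl bracket R z) (quantization scl bracket z)"
  using assms unfolding homeomorphic_map_def quotient_map_def bij_betw_def
  by (simp add: openin_env_topology)

end

theory Submission
  imports Defs
begin

text \<open>
  The tensor functor sends \<open>\<phi>\<close> to an algebra homomorphism \<open>T\<phi>\<close> which commutes with the grading and
  the permutations and maps the relations of the first enveloping algebra to those of the second, so
  it induces \<open>\<Phi>\<close>.  As the quantization map is the restriction of the projection from the tensor algebra,
  it intertwines \<open>T\<phi>\<close> with \<open>\<Phi>\<close>, and \<open>\<Phi>\<close> is continuous because
  \<open>p\<^sub>R (T\<phi> t) \<le> (p \<circ> \<phi>)\<^sub>R t\<close>.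
\<close>

section \<open>Homomorphisms between quotients\<close>

text \<open>The preimage of \<open>J\<close> is an ideal containing \<open>G\<close>, so minimality
  of the generated ideal applies. Descending to a quotient thus only needs a check on the
  relations.\<close>

lemma (in ring_hom_ring) image_genideal_subset:
  assumes "G \<subseteq> carrier R" "ideal J S" "h ` G \<subseteq> J"
  shows "h ` (Idl\<^bsub>R\<^esub> G) \<subseteq> J"
proof -
  have "Idl\<^bsub>R\<^esub> G \<subseteq> {r \<in> carrier R. h r \<in> J}"
    using assms by (intro R.genideal_minimal ideal_vimage) auto
  then show ?thesis by auto
qed

text \<open>If \<open>h\<close> maps the ideal being divided out into \<open>J\<close>, all cosets
  in this union coincide; the union avoids choosing a representative of \<open>X\<close>.\<close>

definition quotient_lift :: "('b, 'n) ring_scheme \<Rightarrow> 'b set \<Rightarrow> ('a \<Rightarrow> 'b) \<Rightarrow> 'a set \<Rightarrow> 'b set"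
  where "quotient_lift B J h X = (\<Union>x\<in>X. J +>\<^bsub>B\<^esub> h x)"

text \<open>Two representatives of a coset differ by some \<open>i\<close> in \<open>I\<close>, and
  \<open>h i\<close> lies in \<open>J\<close>, so the target coset does not change.\<close>

lemma (in ring_hom_ring) quotient_lift_coset:
  assumes I: "ideal I R" and J: "ideal J S" and sub: "h ` I \<subseteq> J" and x: "x \<in> carrier R"
  shows "quotient_lift S J h (I +>\<^bsub>R\<^esub> x) = J +>\<^bsub>S\<^esub> h x"
proof -
  interpret I: ideal I R by fact
  interpret J: ideal J S by fact
  have "J +>\<^bsub>S\<^esub> h y = J +>\<^bsub>S\<^esub> h x" if y: "y \<in> I +>\<^bsub>R\<^esub> x" for y
  proof -
    from y obtain i where i: "i \<in> I" "y = i \<oplus>\<^bsub>R\<^esub> x" unfolding a_r_coset_def' by blast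
    have "h y = h i \<oplus>\<^bsub>S\<^esub> h x" using i x by (simp add: I.Icarr)
    then have "h y \<in> J +>\<^bsub>S\<^esub> h x" using sub i(1) unfolding a_r_coset_def' by blast
    then show ?thesis using J.a_repr_independence' x hom_closed by metis
  qed
  moreover have "x \<in> I +>\<^bsub>R\<^esub> x" using x by (rule I.a_rcos_self)
  ultimately show ?thesis unfolding quotient_lift_def by blast
qed

text \<open>The operations of both quotients are computed on representatives, where \<open>h\<close>
  respects them. It serves twice: from free to tensor algebras and from tensor to enveloping
  algebras.\<close>

lemma quotient_algebra_hom_lift:
  assumes A: "scalar_algebra A" and B: "scalar_algebra B" and h: "h \<in> algebra_hom A B"
    and I: "ideal I A" and J: "ideal J B" and sub: "h ` I \<subseteq> J"
  shows "quotient_lift B J h \<in> algebra_hom (quotient_algebra A I) (quotient_algebra B J)"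
proof -
  interpret A: scalar_algebra A by fact
  interpret B: scalar_algebra B by fact
  have rh: "h \<in> ring_hom A B" and sm: "\<And>c x. x \<in> carrier A \<Longrightarrow> h (c \<odot>\<^bsub>A\<^esub> x) = c \<odot>\<^bsub>B\<^esub> h x"
    using h by (auto simp: algebra_hom_def)
  interpret H: ring_hom_ring A B h by (rule ring_hom_ringI2) (fact A.ring_axioms B.ring_axioms rh)+
  let ?QA = "quotient_algebra A I" and ?QB = "quotient_algebra B J" and ?L = "quotient_lift B J h"
  note qA = quotient_algebra_hom[OF I] and qB = quotient_algebra_hom[OF J]
  note L = H.quotient_lift_coset[OF I J sub]
  have carr: "x \<in> carrier ?QA \<longleftrightarrow> (\<exists>a\<in>carrier A. x = I +>\<^bsub>A\<^esub> a)" for x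
    by (simp add: FactRing_def A_RCOSETS_def' a_r_coset_def)
  have smA: "c \<odot>\<^bsub>?QA\<^esub> (I +>\<^bsub>A\<^esub> a) = I +>\<^bsub>A\<^esub> (c \<odot>\<^bsub>A\<^esub> a)" if "a \<in> carrier A" for c a
    using I that by (rule A.smult_coset)
  have smB: "c \<odot>\<^bsub>?QB\<^esub> (J +>\<^bsub>B\<^esub> b) = J +>\<^bsub>B\<^esub> (c \<odot>\<^bsub>B\<^esub> b)" if "b \<in> carrier B" for c b
    using J that by (rule B.smult_coset)
  have "?L \<in> ring_hom ?QA ?QB"
  proof (rule ring_hom_memI)
    fix x assume "x \<in> carrier ?QA"
    then obtain a where a: "a \<in> carrier A" "x = I +>\<^bsub>A\<^esub> a" using carr by blast
    show "?L x \<in> carrier ?QB"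
      unfolding a(2) L[OF a(1)] by (rule ring_hom_closed[OF qB H.hom_closed[OF a(1)]])
    fix y assume "y \<in> carrier ?QA"
    then obtain b where b: "b \<in> carrier A" "y = I +>\<^bsub>A\<^esub> b" using carr by blast
    show "?L (x \<otimes>\<^bsub>?QA\<^esub> y) = ?L x \<otimes>\<^bsub>?QB\<^esub> ?L y"
      unfolding a(2) b(2) ring_hom_mult[OF qA a(1) b(1), symmetric] L[OF a(1)] L[OF b(1)]
        L[OF A.m_closed[OF a(1) b(1)]] ring_hom_mult[OF rh a(1) b(1)]
      by (rule ring_hom_mult[OF qB H.hom_closed[OF a(1)] H.hom_closed[OF b(1)]])
    show "?L (x \<oplus>\<^bsub>?QA\<^esub> y) = ?L x \<oplus>\<^bsub>?QB\<^esub> ?L y"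
      unfolding a(2) b(2) ring_hom_add[OF qA a(1) b(1), symmetric] L[OF a(1)] L[OF b(1)]
        L[OF A.a_closed[OF a(1) b(1)]] ring_hom_add[OF rh a(1) b(1)]
      by (rule ring_hom_add[OF qB H.hom_closed[OF a(1)] H.hom_closed[OF b(1)]])
  next
    show "?L \<one>\<^bsub>?QA\<^esub> = \<one>\<^bsub>?QB\<^esub>"
      unfolding ring_hom_one[OF qA, symmetric] L[OF A.one_closed] ring_hom_one[OF rh]
      by (rule ring_hom_one[OF qB])
  qed
  moreover have "?L (c \<odot>\<^bsub>?QA\<^esub> x) = c \<odot>\<^bsub>?QB\<^esub> ?L x" if "x \<in> carrier ?QA" for c x
  proof -
    obtain a where a: "a \<in> carrier A" "x = I +>\<^bsub>A\<^esub> a" using \<open>x \<in> carrier ?QA\<close> carr by blast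
    show ?thesis
      unfolding a(2) smA[OF a(1)] L[OF a(1)] smB[OF H.hom_closed[OF a(1)]]
        L[OF A.smult_closed'[OF a(1)]] sm[OF a(1)] ..
  qed
  ultimately show ?thesis unfolding algebra_hom_def by blast
qed

section \<open>The induced map on the free algebra\<close>

text \<open>Push-forward of finitely supported coefficients along \<open>map_fword \<phi>\<close>;
  the coefficients of words that \<open>\<phi>\<close> identifies are added.\<close>

definition map_words :: "('g \<Rightarrow> 'h) \<Rightarrow> ('k::comm_ring_1, 'g) free \<Rightarrow> ('k, 'h) free"
  where "map_words \<phi> f = (\<Sum>w\<in>Poly_Mapping.keys f.
    Poly_Mapping.single (map_fword \<phi> w) (Poly_Mapping.lookup f w))"

lemma letters_map_fword [simp]: "letters (map_fword \<phi> w) = map \<phi> (letters w)"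
  by (cases w) simp

lemma map_fword_add: "map_fword \<phi> (v + w) = map_fword \<phi> v + map_fword \<phi> w"
  by (cases v; cases w) (simp add: plus_fword_def)

lemma map_fword_zero [simp]: "map_fword \<phi> 0 = 0"
  by (simp add: zero_fword_def)

text \<open>An index set common to \<open>f\<close>, \<open>g\<close> and \<open>f + g\<close> lets
  additivity be proved termwise.\<close>

lemma map_words_superset:
  assumes "finite A" "Poly_Mapping.keys f \<subseteq> A"
  shows "map_words \<phi> f =
    (\<Sum>w\<in>A. Poly_Mapping.single (map_fword \<phi> w) (Poly_Mapping.lookup f w))"
  unfolding map_words_def using assms
  by (intro sum.mono_neutral_cong_left) (auto simp: in_keys_iff)

lemma map_words_add: "map_words \<phi> (f + g) = map_words \<phi> f + map_words \<phi> g"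
proof -
  let ?A = "Poly_Mapping.keys f \<union> Poly_Mapping.keys g"
  have "finite ?A" by simp
  moreover have "Poly_Mapping.keys (f + g) \<subseteq> ?A" by (rule keys_add)
  ultimately show ?thesis
    by (simp add: map_words_superset[of ?A] lookup_add single_add flip: sum.distrib)
qed

lemma map_words_zero [simp]: "map_words \<phi> 0 = 0"
  by (simp add: map_words_def)

lemma map_words_diff: "map_words \<phi> (f - g) = map_words \<phi> f - map_words \<phi> g"
  using map_words_add[of \<phi> "f - g" g] by simp

lemma map_words_sum: "map_words \<phi> (\<Sum>i\<in>A. F i) = (\<Sum>i\<in>A. map_words \<phi> (F i))"
  by (induction A rule: infinite_finite_induct) (simp_all add: map_words_add)

lemma map_words_single [simp]:
  "map_words \<phi> (Poly_Mapping.single w c) = Poly_Mapping.single (map_fword \<phi> w) c"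
  using map_words_superset[of "{w}" "Poly_Mapping.single w c" \<phi>] by simp

lemma map_words_one [simp]: "map_words \<phi> 1 = 1"
  using map_words_single[of \<phi> 0 1] by simp

lemma free_expand: "(\<Sum>w\<in>Poly_Mapping.keys f. Poly_Mapping.single w (Poly_Mapping.lookup f w)) = f"
  by (rule poly_mapping_expand) simp_all

text \<open>Both factors are expanded into single words, whose product is concatenation, and
  \<open>map_fword\<close> respects concatenation.\<close>

lemma map_words_mult: "map_words \<phi> (f * g) = map_words \<phi> f * map_words \<phi> g"
proof -
  let ?s = "\<lambda>f w. Poly_Mapping.single w (Poly_Mapping.lookup f w)"
  let ?K = "Poly_Mapping.keys f" and ?L = "Poly_Mapping.keys g"
  have "map_words \<phi> (f * g) = map_words \<phi> ((\<Sum>v\<in>?K. ?s f v) * (\<Sum>w\<in>?L. ?s g w))"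
    by (simp only: free_expand)
  also have "\<dots> = map_words \<phi> f * map_words \<phi> g"
    unfolding map_words_def[of \<phi> f] map_words_def[of \<phi> g] sum_product
    by (simp only: map_words_sum mult_single map_words_single map_fword_add)
  finally show ?thesis .
qed

lemma map_words_hom: "map_words \<phi> \<in> algebra_hom free_algebra free_algebra"
  by (auto simp: algebra_hom_def ring_hom_def map_words_add map_words_mult)

text \<open>Moving letters to other positions commutes with applying \<open>\<phi>\<close> to each
  letter. Both maps are additive, so single words suffice.\<close>

lemma permuted_part_map_words:
  assumes "\<sigma> permutes {..<n}"
  shows "permuted_part n \<sigma> (map_words \<phi> f) = map_words \<phi> (permuted_part n \<sigma> f)"
proof -
  have "permuted_part n \<sigma> (map_words \<phi> (Poly_Mapping.single w c)) =
      map_words \<phi> (permuted_part n \<sigma> (Poly_Mapping.single w c))" for w and c :: 'b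
    using assms by (auto simp: permute_list_map)
  then have "permuted_part n \<sigma> (map_words \<phi> (\<Sum>w\<in>Poly_Mapping.keys f. Poly_Mapping.single w (Poly_Mapping.lookup f w)))
    = map_words \<phi> (permuted_part n \<sigma> (\<Sum>w\<in>Poly_Mapping.keys f. Poly_Mapping.single w (Poly_Mapping.lookup f w)))"
    by (simp only: map_words_sum permuted_part_sum)
  then show ?thesis by (simp only: free_expand)
qed

section \<open>The induced map on tensors\<close>

definition tensor_map ::
    "('k::comm_ring_1 \<Rightarrow> 'h::ab_group_add \<Rightarrow> 'h) \<Rightarrow> ('g \<Rightarrow> 'h) \<Rightarrow> ('k, 'g) tensor \<Rightarrow> ('k, 'h) tensor"
  where "tensor_map scale_h \<phi> = quotient_lift free_algebra (tensor_ideal scale_h) (map_words \<phi>)"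

definition env_map ::
    "('k::comm_ring_1 \<Rightarrow> 'h::ab_group_add \<Rightarrow> 'h) \<Rightarrow> ('h \<Rightarrow> 'h \<Rightarrow> 'h) \<Rightarrow> 'k \<Rightarrow> ('g \<Rightarrow> 'h) \<Rightarrow>
     ('k, 'g) env \<Rightarrow> ('k, 'h) env"
  where "env_map scale_h bracket_h z \<phi> =
    quotient_lift (tensor_algebra scale_h) (env_ideal scale_h bracket_h z) (tensor_map scale_h \<phi>)"

lemma ring_hom_ring_map_words:
  "ring_hom_ring free_algebra free_algebra
    (map_words \<phi> :: ('k::comm_ring_1, 'g) free \<Rightarrow> ('k, 'h) free)"
  using map_words_hom by (intro ring_hom_ringI2 ring_free_algebra) (auto simp: algebra_hom_def)

lemma ring_hom_ring_tensor_class: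
  "ring_hom_ring free_algebra (tensor_algebra scl) (tensor_class scl)"
  by (intro ring_hom_ringI2 ring_free_algebra tensor_class_hom
      scalar_algebra.axioms(1)[OF scalar_algebra_tensor])

lemma tensor_class_diff:
  "tensor_class scl f \<ominus>\<^bsub>tensor_algebra scl\<^esub> tensor_class scl g = tensor_class scl (f - g)"
proof -
  interpret H: ring_hom_ring free_algebra "tensor_algebra scl" "tensor_class scl"
    by (rule ring_hom_ring_tensor_class)
  have "tensor_class scl (f \<ominus>\<^bsub>free_algebra\<^esub> g) =
      tensor_class scl f \<ominus>\<^bsub>tensor_algebra scl\<^esub> tensor_class scl g"
    unfolding a_minus_def using H.hom_add[of f "\<ominus>\<^bsub>free_algebra\<^esub> g"] H.hom_a_inv[of g] H.R.a_inv_closed[of g]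
    by (simp del: free_algebra_simps(5))
  then show ?thesis by simp
qed

lemma tensor_incl_mem [simp]: "tensor_incl scl x \<in> carrier (tensor_algebra scl)"
  by (auto simp: carrier_tensor tensor_incl_def)

context
  fixes scale_g :: "'k::comm_ring_1 \<Rightarrow> 'g::ab_group_add \<Rightarrow> 'g"
    and scale_h :: "'k \<Rightarrow> 'h::ab_group_add \<Rightarrow> 'h" and \<phi> :: "'g \<Rightarrow> 'h"
  assumes add: "\<And>x y. \<phi> (x + y) = \<phi> x + \<phi> y"
    and scale: "\<And>c x. \<phi> (scale_g c x) = scale_h c (\<phi> x)"
begin

text \<open>Linearity of \<open>\<phi>\<close> enters here: each linear relation goes to the same
  relation between the images, and the generated ideals follow.\<close>

lemma map_words_tensor_ideal: "map_words \<phi> ` tensor_ideal scale_g \<subseteq> tensor_ideal scale_h"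
proof -
  have "map_words \<phi> r \<in> linear_relations scale_h" if "r \<in> linear_relations scale_g" for r
    using that unfolding linear_relations_def
    by (elim UnE CollectE exE conjE)
      (simp add: map_words_diff map_words_add map_words_mult add scale; blast)+
  then have "map_words \<phi> ` linear_relations scale_g \<subseteq> linear_relations scale_h" by blast
  also have "\<dots> \<subseteq> tensor_ideal scale_h"
    unfolding tensor_ideal_def by (rule ring.genideal_self[OF ring_free_algebra]) simp
  finally show ?thesis
    unfolding tensor_ideal_def[of scale_g]
    by (intro ring_hom_ring.image_genideal_subset[OF ring_hom_ring_map_words _ ideal_tensor_ideal]) auto
qed

lemma tensor_map_class: "tensor_map scale_h \<phi> (tensor_class scale_g f) = tensor_class scale_h (map_words \<phi> f)"
  unfolding tensor_map_def tensor_class_def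
  by (rule ring_hom_ring.quotient_lift_coset[OF ring_hom_ring_map_words ideal_tensor_ideal
        ideal_tensor_ideal map_words_tensor_ideal]) simp

lemma tensor_map_hom: "tensor_map scale_h \<phi> \<in> algebra_hom (tensor_algebra scale_g) (tensor_algebra scale_h)"
  unfolding tensor_map_def tensor_algebra_def
  by (rule quotient_algebra_hom_lift[OF scalar_algebra_free scalar_algebra_free map_words_hom
        ideal_tensor_ideal ideal_tensor_ideal map_words_tensor_ideal])

lemma tensor_map_incl: "tensor_map scale_h \<phi> (tensor_incl scale_g x) = tensor_incl scale_h (\<phi> x)"
  by (simp add: tensor_incl_def tensor_map_class)

lemma tensor_map_diff:
  assumes "s \<in> carrier (tensor_algebra scale_g)" "t \<in> carrier (tensor_algebra scale_g)"
  shows "tensor_map scale_h \<phi> (s \<ominus>\<^bsub>tensor_algebra scale_g\<^esub> t) =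
    tensor_map scale_h \<phi> s \<ominus>\<^bsub>tensor_algebra scale_h\<^esub> tensor_map scale_h \<phi> t"
  using assms by (auto simp: carrier_tensor tensor_class_diff tensor_map_class map_words_diff)

lemma component_tensor_map:
  assumes "t \<in> carrier (tensor_algebra scale_g)"
  shows "component scale_h n (tensor_map scale_h \<phi> t) = tensor_map scale_h \<phi> (component scale_g n t)"
  using assms by (auto simp: component_def carrier_tensor tensor_map_class permuted_component_class
      permutes_id permuted_part_map_words)

text \<open>A class is symmetric when permuting a representative changes each degree only by an
  element of the tensor ideal. \<open>map_words\<close> commutes with the permutations and preserves
  the ideals.\<close>

lemma tensor_map_symmetric:
  assumes t: "t \<in> symmetric_tensors scale_g"
  shows "tensor_map scale_h \<phi> t \<in> symmetric_tensors scale_h"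
proof -
  obtain f where f: "t = tensor_class scale_g f"
    using t by (auto simp: symmetric_tensors_def carrier_tensor)
  have "permuted_part n \<sigma> (map_words \<phi> f) - permuted_part n id (map_words \<phi> f) \<in> tensor_ideal scale_h"
    if "\<sigma> permutes {..<n}" for n \<sigma>
  proof -
    have "permuted_part n \<sigma> f - permuted_part n id f \<in> tensor_ideal scale_g"
      using t that by (simp add: f tensor_class_mem_symmetric_iff)
    then have "map_words \<phi> (permuted_part n \<sigma> f - permuted_part n id f) \<in> tensor_ideal scale_h"
      using map_words_tensor_ideal by blast
    then show ?thesis using that by (simp add: map_words_diff permuted_part_map_words permutes_id)
  qed
  then show ?thesis by (simp add: f tensor_map_class tensor_class_mem_symmetric_iff)
qed

section \<open>Descent to the universal enveloping algebras\<close>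

context
  fixes bracket_g :: "'g \<Rightarrow> 'g \<Rightarrow> 'g" and bracket_h :: "'h \<Rightarrow> 'h \<Rightarrow> 'h" and z :: 'k
  assumes bracket: "\<And>x y. \<phi> (bracket_g x y) = bracket_h (\<phi> x) (\<phi> y)"
begin

text \<open>As \<open>\<phi>\<close> preserves brackets, the relation for \<open>x\<close> and
  \<open>y\<close> goes to the relation for \<open>\<phi> x\<close> and \<open>\<phi> y\<close>,
  with the same \<open>z\<close>.\<close>

lemma tensor_map_env_ideal:
  "tensor_map scale_h \<phi> ` env_ideal scale_g bracket_g z \<subseteq> env_ideal scale_h bracket_h z"
proof -
  let ?Tg = "tensor_algebra scale_g" and ?Th = "tensor_algebra scale_h" and ?T = "tensor_map scale_h \<phi>"
  interpret Tg: scalar_algebra ?Tg by (rule scalar_algebra_tensor)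
  interpret Th: scalar_algebra ?Th by (rule scalar_algebra_tensor)
  have rh: "?T \<in> ring_hom ?Tg ?Th"
    and sm: "\<And>c x. x \<in> carrier ?Tg \<Longrightarrow> ?T (c \<odot>\<^bsub>?Tg\<^esub> x) = c \<odot>\<^bsub>?Th\<^esub> ?T x"
    using tensor_map_hom by (auto simp: algebra_hom_def)
  interpret H: ring_hom_ring ?Tg ?Th ?T
    by (rule ring_hom_ringI2) (fact Tg.ring_axioms Th.ring_axioms rh)+
  have "?T r \<in> env_relations scale_h bracket_h z" if "r \<in> env_relations scale_g bracket_g z" for r
    using that unfolding env_relations_def
    by (elim CollectE exE conjE)
      (simp add: tensor_map_diff tensor_map_incl sm bracket Tg.minus_closed; blast)
  then have "?T ` env_relations scale_g bracket_g z \<subseteq> env_relations scale_h bracket_h z" by blast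
  also have "\<dots> \<subseteq> env_ideal scale_h bracket_h z"
    unfolding env_ideal_def
    by (rule Th.genideal_self) (auto simp: env_relations_def intro!: Th.minus_closed)
  finally show ?thesis
    unfolding env_ideal_def[of scale_g]
    by (intro H.image_genideal_subset ideal_env_ideal)
      (auto simp: env_relations_def intro!: Tg.minus_closed)
qed

lemma env_map_hom:
  "env_map scale_h bracket_h z \<phi> \<in>
    algebra_hom (env_algebra scale_g bracket_g z) (env_algebra scale_h bracket_h z)"
  unfolding env_map_def env_algebra_def
  by (rule quotient_algebra_hom_lift[OF scalar_algebra_tensor scalar_algebra_tensor tensor_map_hom
        ideal_env_ideal ideal_env_ideal tensor_map_env_ideal])

text \<open>This formula yields both the compatibility with the quantization maps and the one with
  the inclusions of the Lie algebras.\<close>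

lemma env_map_coset:
  assumes "t \<in> carrier (tensor_algebra scale_g)"
  shows "env_map scale_h bracket_h z \<phi> (env_ideal scale_g bracket_g z +>\<^bsub>tensor_algebra scale_g\<^esub> t) =
    env_ideal scale_h bracket_h z +>\<^bsub>tensor_algebra scale_h\<^esub> tensor_map scale_h \<phi> t"
proof -
  have "ring_hom_ring (tensor_algebra scale_g) (tensor_algebra scale_h) (tensor_map scale_h \<phi>)"
    using tensor_map_hom
    by (intro ring_hom_ringI2 scalar_algebra.axioms(1)[OF scalar_algebra_tensor])
      (simp add: algebra_hom_def)
  then show ?thesis
    unfolding env_map_def using assms
    by (rule ring_hom_ring.quotient_lift_coset[OF _ ideal_env_ideal ideal_env_ideal tensor_map_env_ideal])
qed

end

end

section \<open>Projective seminorms\<close>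

text \<open>The quantity minimized in \<open>projective_power\<close>; \<open>f\<close> is one way
  of writing a tensor as a combination of elementary tensors.\<close>

definition words_cost :: "('g \<Rightarrow> real) \<Rightarrow> ('k::real_normed_field, 'g) free \<Rightarrow> real"
  where "words_cost p f = (\<Sum>w\<in>Poly_Mapping.keys f.
    norm (Poly_Mapping.lookup f w) * prod_list (map p (letters w)))"

definition homogeneous :: "nat \<Rightarrow> ('k::zero, 'g) free \<Rightarrow> bool"
  where "homogeneous n f \<longleftrightarrow> (\<forall>w\<in>Poly_Mapping.keys f. length (letters w) = n)"

lemma projective_power_eq:
  "projective_power scl p n t = Inf {words_cost p f | f. homogeneous n f \<and> tensor_class scl f = t}"
  by (simp add: projective_power_def words_cost_def homogeneous_def)

lemma homogeneous_zero: "homogeneous n 0"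
  by (simp add: homogeneous_def)

lemma homogeneous_add: "homogeneous n f \<Longrightarrow> homogeneous n g \<Longrightarrow> homogeneous n (f + g)"
  unfolding homogeneous_def using keys_add[of f g] by blast

lemma homogeneous_sum: "(\<And>i. i \<in> A \<Longrightarrow> homogeneous n (F i)) \<Longrightarrow> homogeneous n (\<Sum>i\<in>A. F i)"
  by (induction A rule: infinite_finite_induct) (auto intro: homogeneous_zero homogeneous_add)

lemma homogeneous_single: "length (letters w) = n \<Longrightarrow> homogeneous n (Poly_Mapping.single w c)"
  by (simp add: homogeneous_def)

text \<open>Every component of a tensor hence has a homogeneous representative, so the infimum in
  \<open>projective_power\<close> is over a nonempty set.\<close>

lemma homogeneous_permuted_part: "homogeneous n (permuted_part n \<sigma> f)"
  unfolding permuted_part_def by (intro homogeneous_sum homogeneous_single) simp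

lemma homogeneous_map_words: "homogeneous n f \<Longrightarrow> homogeneous n (map_words \<phi> f)"
  unfolding map_words_def by (intro homogeneous_sum homogeneous_single) (simp add: homogeneous_def)

lemma words_cost_zero [simp]: "words_cost p 0 = 0"
  by (simp add: words_cost_def)

lemma words_cost_single [simp]:
  "words_cost p (Poly_Mapping.single w c) = norm c * prod_list (map p (letters w))"
  by (simp add: words_cost_def)

context
  fixes p :: "'g::ab_group_add \<Rightarrow> real"
  assumes p_nonneg: "\<And>x. 0 \<le> p x"
begin

lemma prod_list_map_nonneg: "0 \<le> prod_list (map p xs)"
  by (induction xs) (simp_all add: p_nonneg)

lemma words_cost_nonneg: "0 \<le> words_cost p f"
  unfolding words_cost_def by (intro sum_nonneg mult_nonneg_nonneg prod_list_map_nonneg) simp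

lemma words_cost_superset:
  assumes "finite A" "Poly_Mapping.keys f \<subseteq> A"
  shows "words_cost p f = (\<Sum>w\<in>A. norm (Poly_Mapping.lookup f w) * prod_list (map p (letters w)))"
  unfolding words_cost_def using assms
  by (intro sum.mono_neutral_cong_left) (auto simp: in_keys_iff)

text \<open>Over the union of the supports this is the triangle inequality for the coefficients,
  weighted by nonnegative products.\<close>

lemma words_cost_add: "words_cost p (f + g) \<le> words_cost p f + words_cost p g"
proof -
  let ?A = "Poly_Mapping.keys f \<union> Poly_Mapping.keys g"
  have "words_cost p (f + g) = (\<Sum>w\<in>?A. norm (Poly_Mapping.lookup (f + g) w) * prod_list (map p (letters w)))"
    by (rule words_cost_superset) (use keys_add[of f g] in auto)
  also have "\<dots> \<le> (\<Sum>w\<in>?A. norm (Poly_Mapping.lookup f w) * prod_list (map p (letters w)) +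
      norm (Poly_Mapping.lookup g w) * prod_list (map p (letters w)))"
    unfolding distrib_right[symmetric] lookup_add
    by (intro sum_mono mult_right_mono norm_triangle_ineq prod_list_map_nonneg)
  also have "\<dots> = words_cost p f + words_cost p g"
    by (simp add: sum.distrib words_cost_superset[of ?A])
  finally show ?thesis .
qed

lemma words_cost_sum: "words_cost p (\<Sum>i\<in>A. F i) \<le> (\<Sum>i\<in>A. words_cost p (F i))"
proof (induction A rule: infinite_finite_induct)
  case (insert x A)
  then show ?case using words_cost_add[of "F x" "sum F A"] by simp
qed simp_all

text \<open>A single word costs the same on both sides. The inequality arises because words
  identified by \<open>\<phi>\<close> have their coefficients merged, possibly with
  cancellation.\<close>

lemma words_cost_map_words: "words_cost p (map_words \<phi> f) \<le> words_cost (p \<circ> \<phi>) f"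
proof -
  have "words_cost p (map_words \<phi> f) \<le> (\<Sum>w\<in>Poly_Mapping.keys f.
      words_cost p (Poly_Mapping.single (map_fword \<phi> w) (Poly_Mapping.lookup f w)))"
    unfolding map_words_def by (rule words_cost_sum)
  also have "\<dots> = words_cost (p \<circ> \<phi>) f" by (simp add: words_cost_def[of "p \<circ> \<phi>"])
  finally show ?thesis .
qed

section \<open>The projective power as an infimum over representatives\<close>

lemma projective_power_le:
  assumes "homogeneous n f"
  shows "projective_power scl p n (tensor_class scl f) \<le> words_cost p f"
  unfolding projective_power_eq
  by (rule cInf_lower) (use assms words_cost_nonneg in \<open>auto intro!: bdd_belowI[of _ 0]\<close>)

lemma projective_power_nonneg:
  assumes "homogeneous n f"
  shows "0 \<le> projective_power scl p n (tensor_class scl f)"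
  unfolding projective_power_eq
  by (rule cInf_greatest) (use assms words_cost_nonneg in auto)

lemma projective_power_zero: "projective_power scl p n (tensor_class scl 0) = 0"
  using projective_power_le[OF homogeneous_zero] projective_power_nonneg[OF homogeneous_zero]
  by (intro antisym) simp_all

text \<open>The argument for quotient seminorms: sums of homogeneous representatives represent the
  sum, and their cost is subadditive.\<close>

lemma projective_power_add:
  assumes f: "homogeneous n f" and g: "homogeneous n g"
  shows "projective_power scl p n (tensor_class scl (f + g)) \<le>
    projective_power scl p n (tensor_class scl f) + projective_power scl p n (tensor_class scl g)"
    (is "?P (f + g) \<le> ?P f + ?P g")
proof -
  have add: "tensor_class scl (f' + g') = tensor_class scl (f + g)"
    if "tensor_class scl f' = tensor_class scl f" "tensor_class scl g' = tensor_class scl g" for f' g'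
    using ring_hom_add[OF tensor_class_hom, of f' g' scl] ring_hom_add[OF tensor_class_hom, of f g scl] that
    by simp
  have *: "?P (f + g) \<le> words_cost p f' + words_cost p g'"
    if "homogeneous n f'" "tensor_class scl f' = tensor_class scl f"
      "homogeneous n g'" "tensor_class scl g' = tensor_class scl g" for f' g'
    using projective_power_le[OF homogeneous_add[OF that(1,3)], of scl] words_cost_add[of f' g']
      add[OF that(2,4)] by simp
  \<comment> \<open>The two infima are taken one after the other: first over representatives of
    \<open>g\<close> with \<open>f'\<close> fixed, then over those of \<open>f\<close>.\<close>
  have "?P (f + g) - words_cost p f' \<le> ?P g"
    if "homogeneous n f'" "tensor_class scl f' = tensor_class scl f" for f'
    unfolding projective_power_eq[of scl p n "tensor_class scl g"]
    by (rule cInf_greatest) (use g *[OF that] in \<open>auto simp: algebra_simps\<close>)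
  then have "?P (f + g) - ?P g \<le> ?P f"
    unfolding projective_power_eq[of scl p n "tensor_class scl f"]
    by (intro cInf_greatest) (use f in \<open>auto simp: algebra_simps\<close>)
  then show ?thesis by simp
qed

section \<open>Assembling the degrees into \<open>tensor_seminorm\<close>\<close>

lemma tensor_seminorm_terms_zero:
  assumes "\<And>w. w \<in> Poly_Mapping.keys f \<Longrightarrow> length (letters w) \<noteq> n"
  shows "projective_power scl p n (component scl n (tensor_class scl f)) = 0"
proof -
  have "{w \<in> Poly_Mapping.keys f. length (letters w) = n} = {}" using assms by blast
  then have "permuted_part n id f = 0" unfolding permuted_part_def by (simp only: sum.empty)
  then show ?thesis
    by (simp add: component_def permuted_component_class permutes_id projective_power_zero)
qed

text \<open>Only the lengths of words occurring in \<open>f\<close> contribute. Summability is what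
  permits adding and comparing the series termwise.\<close>

lemma summable_tensor_seminorm:
  "summable (\<lambda>n. fact n powr R * projective_power scl p n (component scl n (tensor_class scl f)))"
proof (rule summable_finite[of "(\<lambda>w. length (letters w)) ` Poly_Mapping.keys f"])
  show "fact n powr R * projective_power scl p n (component scl n (tensor_class scl f)) = 0"
    if "n \<notin> (\<lambda>w. length (letters w)) ` Poly_Mapping.keys f" for n
    using tensor_seminorm_terms_zero[of f n scl] that by fastforce
qed simp

lemma tensor_seminorm_zero: "tensor_seminorm scl R p (tensor_class scl 0) = 0"
proof -
  have "projective_power scl p n (component scl n (tensor_class scl 0)) = 0" for n
    by (rule tensor_seminorm_terms_zero) simp
  then show ?thesis unfolding tensor_seminorm_def by simp
qed

lemma tensor_seminorm_add:
  "tensor_seminorm scl R p (tensor_class scl (f + g)) \<le>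
    tensor_seminorm scl R p (tensor_class scl f) + tensor_seminorm scl R p (tensor_class scl g)"
  unfolding tensor_seminorm_def suminf_add[OF summable_tensor_seminorm summable_tensor_seminorm]
proof (intro suminf_le summable_add summable_tensor_seminorm)
  show "fact n powr R * projective_power scl p n (component scl n (tensor_class scl (f + g))) \<le>
      fact n powr R * projective_power scl p n (component scl n (tensor_class scl f)) +
      fact n powr R * projective_power scl p n (component scl n (tensor_class scl g))" for n
    unfolding distrib_left[symmetric] component_def permuted_component_class[OF permutes_id] permuted_part_add
    by (intro mult_left_mono projective_power_add homogeneous_permuted_part) simp
qed

end

section \<open>Continuity of the induced map\<close>

text \<open>Subadditivity and homogeneity give
  \<open>0 = p 0 \<le> p x + p (- x) = 2 * p x\<close>.\<close>

lemma seminorm_nonneg: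
  assumes vs: "vector_space scl" and p: "seminorm scl p"
  shows "0 \<le> p x"
proof -
  interpret vector_space scl by (rule vs)
  have tri: "p (x + y) \<le> p x + p y" and hom: "p (scl c x) = norm c * p x" for c x y
    using p by (auto simp: seminorm_def)
  have "p (- x) = p x" using hom[of "-1" x] by simp
  moreover have "p 0 = 0" using hom[of 0 0] by simp
  ultimately show ?thesis using tri[of x "- x"] by simp
qed

lemma openin_symmetric_topology_ball:
  assumes "continuous_seminorm scl p" "t \<in> symmetric_tensors scl" "\<epsilon> > 0"
  shows "openin (symmetric_topology scl R)
    {s \<in> symmetric_tensors scl. tensor_seminorm scl R p (s \<ominus>\<^bsub>tensor_algebra scl\<^esub> t) < \<epsilon>}"
  unfolding symmetric_topology_def
  by (rule topology_generated_by_Basis) (use assms in blast)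

context
  fixes scale_g :: "'k::real_normed_field \<Rightarrow> 'g::{topological_space, ab_group_add} \<Rightarrow> 'g"
    and scale_h :: "'k \<Rightarrow> 'h::{topological_space, ab_group_add} \<Rightarrow> 'h" and \<phi> :: "'g \<Rightarrow> 'h"
  assumes linear: "Vector_Spaces.linear scale_g scale_h \<phi>"
    and cont: "continuous_on UNIV \<phi>"
begin

interpretation Vector_Spaces.linear scale_g scale_h \<phi> by (rule linear)

text \<open>In each degree, \<open>map_words\<close> turns a representative of the source component
  into one of the target component at no higher cost, so the infimum can only drop.\<close>

lemma tensor_seminorm_tensor_map:
  assumes p: "seminorm scale_h p" and t: "t \<in> carrier (tensor_algebra scale_g)"
  shows "tensor_seminorm scale_h R p (tensor_map scale_h \<phi> t) \<le> tensor_seminorm scale_g R (p \<circ> \<phi>) t"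
proof -
  have nn: "0 \<le> p x" for x by (rule seminorm_nonneg[OF vs2.vector_space_axioms p])
  then have nn': "0 \<le> (p \<circ> \<phi>) x" for x by simp
  obtain f where f: "t = tensor_class scale_g f" using t by (auto simp: carrier_tensor)
  have "projective_power scale_h p n (tensor_map scale_h \<phi> (tensor_class scale_g g)) \<le>
      projective_power scale_g (p \<circ> \<phi>) n (tensor_class scale_g g)" if g: "homogeneous n g" for n g
    unfolding projective_power_eq[of scale_g]
  proof (rule cInf_greatest)
    fix c assume "c \<in> {words_cost (p \<circ> \<phi>) g' |g'. homogeneous n g' \<and> tensor_class scale_g g' = tensor_class scale_g g}"
    then obtain g' where g': "homogeneous n g'" "tensor_class scale_g g' = tensor_class scale_g g"
      "c = words_cost (p \<circ> \<phi>) g'" by blast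
    have "projective_power scale_h p n (tensor_map scale_h \<phi> (tensor_class scale_g g')) \<le> words_cost p (map_words \<phi> g')"
      unfolding tensor_map_class[of \<phi> scale_g scale_h, OF add scale]
      by (intro projective_power_le homogeneous_map_words g'(1) nn)
    also have "\<dots> \<le> c" unfolding g'(3) by (rule words_cost_map_words) (rule nn)
    finally show "projective_power scale_h p n (tensor_map scale_h \<phi> (tensor_class scale_g g)) \<le> c"
      unfolding g'(2) .
  qed (use g in blast)
  \<comment> \<open>\<open>tensor_map\<close> commutes with taking components, and these have
    homogeneous representatives, so the estimate applies degree by degree.\<close>
  then have "projective_power scale_h p n (component scale_h n (tensor_map scale_h \<phi> t)) \<le>
      projective_power scale_g (p \<circ> \<phi>) n (component scale_g n t)" for n
    unfolding component_tensor_map[of \<phi> scale_g scale_h, OF add scale t]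
    unfolding component_def f permuted_component_class[OF permutes_id]
    by (simp add: homogeneous_permuted_part)
  then show ?thesis
    unfolding tensor_seminorm_def
  proof (intro suminf_le mult_left_mono)
    show "summable (\<lambda>n. fact n powr R * projective_power scale_h p n (component scale_h n (tensor_map scale_h \<phi> t)))"
      unfolding f tensor_map_class[of \<phi> scale_g scale_h, OF add scale]
      by (rule summable_tensor_seminorm) (rule nn)
    show "summable (\<lambda>n. fact n powr R * projective_power scale_g (p \<circ> \<phi>) n (component scale_g n t))"
      unfolding f by (rule summable_tensor_seminorm) (rule nn')
  qed simp_all
qed

text \<open>Continuity of \<open>\<phi>\<close> enters here: it makes
  \<open>p \<circ> \<phi>\<close> one of the seminorms that define the source topology.\<close>

lemma continuous_seminorm_comp:
  assumes "continuous_seminorm scale_h p"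
  shows "continuous_seminorm scale_g (p \<circ> \<phi>)"
proof -
  have "continuous_on UNIV (p \<circ> \<phi>)"
    using assms cont unfolding continuous_seminorm_def
    by (intro continuous_on_compose) (auto intro: continuous_on_subset)
  then show ?thesis
    using assms by (auto simp: continuous_seminorm_def seminorm_def add scale)
qed

text \<open>The target topology is generated by balls, so it suffices that the preimage of each ball
  contains a source ball around each of its points.\<close>

lemma continuous_map_tensor_map:
  "continuous_map (symmetric_topology scale_g R) (symmetric_topology scale_h R) (tensor_map scale_h \<phi>)"
proof -
  let ?Tg = "tensor_algebra scale_g" and ?Th = "tensor_algebra scale_h" and ?T = "tensor_map scale_h \<phi>"
    and ?Sg = "symmetric_tensors scale_g" and ?Sh = "symmetric_tensors scale_h"
  note T_class = tensor_map_class[of \<phi> scale_g scale_h, OF add scale]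
  note T_sym = tensor_map_symmetric[of \<phi> scale_g scale_h, OF add scale]
  have Sg: "s \<in> carrier ?Tg" if "s \<in> ?Sg" for s using that by (simp add: symmetric_tensors_def)
  have Sh: "s \<in> carrier ?Th" if "s \<in> ?Sh" for s using that by (simp add: symmetric_tensors_def)
  have ball: "openin (symmetric_topology scale_g R) {s \<in> ?Sg. tensor_seminorm scale_h R p (?T s \<ominus>\<^bsub>?Th\<^esub> t) < \<epsilon>}"
    (is "openin _ ?B") if p: "continuous_seminorm scale_h p" and t: "t \<in> ?Sh" for p t \<epsilon>
  proof (subst openin_subopen, intro ballI)
    fix s assume s: "s \<in> ?B"
    have sn: "seminorm scale_h p" using p by (simp add: continuous_seminorm_def)
    have nn: "0 \<le> p x" for x by (rule seminorm_nonneg[OF vs2.vector_space_axioms sn])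
    then have nn': "0 \<le> (p \<circ> \<phi>) x" for x by simp
    obtain f g where f: "s = tensor_class scale_g f" and g: "t = tensor_class scale_h g"
      using s Sg[of s] Sh[OF t] by (auto simp: carrier_tensor)
    \<comment> \<open>The distance left from \<open>?T s\<close> to the boundary of the ball; it
      serves as radius around \<open>s\<close>.\<close>
    define \<delta> where "\<delta> = \<epsilon> - tensor_seminorm scale_h R p (?T s \<ominus>\<^bsub>?Th\<^esub> t)"
    have \<delta>: "\<delta> > 0" using s by (simp add: \<delta>_def)
    let ?N = "{u \<in> ?Sg. tensor_seminorm scale_g R (p \<circ> \<phi>) (u \<ominus>\<^bsub>?Tg\<^esub> s) < \<delta>}"
    have "openin (symmetric_topology scale_g R) ?N"
      using s \<delta> by (intro openin_symmetric_topology_ball continuous_seminorm_comp p) auto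
    moreover have "s \<in> ?N"
      using s \<delta> tensor_seminorm_zero[of "p \<circ> \<phi>" scale_g R, OF nn'] by (auto simp: f tensor_class_diff)
    moreover have "?N \<subseteq> ?B"
    proof
      fix u assume u: "u \<in> ?N"
      then obtain h where h: "u = tensor_class scale_g h" using Sg[of u] by (auto simp: carrier_tensor)
      \<comment> \<open>On representatives, \<open>?T u - t\<close> splits as
        \<open>?T (u - s)\<close> plus \<open>?T s - t\<close>.\<close>
      have "?T u \<ominus>\<^bsub>?Th\<^esub> t = tensor_class scale_h (map_words \<phi> (h - f) + (map_words \<phi> f - g))"
        by (simp add: h g T_class tensor_class_diff map_words_diff)
      then have "tensor_seminorm scale_h R p (?T u \<ominus>\<^bsub>?Th\<^esub> t) \<le>
          tensor_seminorm scale_h R p (?T (u \<ominus>\<^bsub>?Tg\<^esub> s)) + tensor_seminorm scale_h R p (?T s \<ominus>\<^bsub>?Th\<^esub> t)"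
        using tensor_seminorm_add[of p scale_h R "map_words \<phi> (h - f)" "map_words \<phi> f - g", OF nn]
        by (simp add: f g h T_class tensor_class_diff)
      also have "tensor_seminorm scale_h R p (?T (u \<ominus>\<^bsub>?Tg\<^esub> s)) \<le>
          tensor_seminorm scale_g R (p \<circ> \<phi>) (u \<ominus>\<^bsub>?Tg\<^esub> s)"
        by (rule tensor_seminorm_tensor_map[OF sn]) (simp add: f h tensor_class_diff carrier_tensor)
      also have "\<dots> < \<delta>" using u by simp
      finally show "u \<in> ?B" using u by (simp add: \<delta>_def)
    qed
    ultimately show "\<exists>N. openin (symmetric_topology scale_g R) N \<and> s \<in> N \<and> N \<subseteq> ?B" by blast
  qed
  show ?thesis
    unfolding symmetric_topology_def[of scale_h]
  proof (rule continuous_on_generated_topo)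
    fix U assume "U \<in> {{s \<in> ?Sh. tensor_seminorm scale_h R p (s \<ominus>\<^bsub>?Th\<^esub> t) < \<epsilon>} | p t \<epsilon>.
        continuous_seminorm scale_h p \<and> t \<in> ?Sh \<and> \<epsilon> > 0}"
    then obtain p t \<epsilon> where U: "U = {s \<in> ?Sh. tensor_seminorm scale_h R p (s \<ominus>\<^bsub>?Th\<^esub> t) < \<epsilon>}"
      and pt: "continuous_seminorm scale_h p" "t \<in> ?Sh" by blast
    have "?T -` U \<inter> topspace (symmetric_topology scale_g R) =
        {s \<in> ?Sg. tensor_seminorm scale_h R p (?T s \<ominus>\<^bsub>?Th\<^esub> t) < \<epsilon>}"
      unfolding U using T_sym by auto
    then show "openin (symmetric_topology scale_g R) (?T -` U \<inter> topspace (symmetric_topology scale_g R))"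
      using ball[OF pt] by simp
  next
    \<comment> \<open>The generating balls cover exactly the symmetric tensors, which
      \<open>?T\<close> preserves.\<close>
    show "?T ` topspace (symmetric_topology scale_g R) \<subseteq>
        \<Union> {{s \<in> ?Sh. tensor_seminorm scale_h R p (s \<ominus>\<^bsub>?Th\<^esub> t) < \<epsilon>} | p t \<epsilon>.
          continuous_seminorm scale_h p \<and> t \<in> ?Sh \<and> \<epsilon> > 0}"
      using T_sym topspace_symmetric_topology[of scale_h R, unfolded symmetric_topology_def topology_generated_by_topspace]
      by (simp add: image_subset_iff)
  qed
qed

text \<open>Openness in either enveloping algebra is tested on the preimage under quantization, so
  the commuting square of quantizations reduces the claim to continuity of
  \<open>tensor_map\<close>.\<close>

lemma continuous_map_env_map:
  assumes bracket: "\<And>x y. \<phi> (bracket_g x y) = bracket_h (\<phi> x) (\<phi> y)"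
  shows "continuous_map (env_topology scale_g bracket_g R z) (env_topology scale_h bracket_h R z)
    (env_map scale_h bracket_h z \<phi>)"
proof -
  let ?Ug = "env_algebra scale_g bracket_g z" and ?Uh = "env_algebra scale_h bracket_h z"
    and ?F = "env_map scale_h bracket_h z \<phi>" and ?T = "tensor_map scale_h \<phi>"
    and ?Sg = "symmetric_tensors scale_g" and ?Sh = "symmetric_tensors scale_h"
    and ?qg = "quantization scale_g bracket_g z" and ?qh = "quantization scale_h bracket_h z"
  have closed: "?F x \<in> carrier ?Uh" if "x \<in> carrier ?Ug" for x
    using env_map_hom[of \<phi> scale_g scale_h bracket_g bracket_h z, OF add scale bracket] that
    by (auto simp: algebra_hom_def intro: ring_hom_closed)
  \<comment> \<open>Both quantizations are the coset projections on symmetric tensors, and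
    \<open>env_map\<close> was induced from \<open>?T\<close> on cosets.\<close>
  have q: "?F (?qg s) = ?qh (?T s)" if s: "s \<in> ?Sg" for s
    unfolding quantization_eq_projection[OF s]
      quantization_eq_projection[OF tensor_map_symmetric[of \<phi> scale_g scale_h, OF add scale s]]
    using s by (intro env_map_coset add scale bracket) (simp add: symmetric_tensors_def)
  have qg: "?qg s \<in> carrier ?Ug" if "s \<in> ?Sg" for s
    using is_quantization_quantization[of scale_g bracket_g z] that
    unfolding is_quantization_def Let_def by blast
  have "openin (env_topology scale_g bracket_g R z) {x \<in> carrier ?Ug. ?F x \<in> V}"
    if V: "openin (env_topology scale_h bracket_h R z) V" for V
  proof -
    let ?W = "{t \<in> ?Sh. ?qh t \<in> V}"
    have "openin (symmetric_topology scale_h R) ?W" using V by (simp add: openin_env_topology)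
    then have "openin (symmetric_topology scale_g R) {s \<in> ?Sg. ?T s \<in> ?W}"
      using continuous_map_tensor_map[of R] unfolding continuous_map topspace_symmetric_topology by blast
    \<comment> \<open>By \<open>q\<close>, the conditions \<open>?qh (?T s) \<in> V\<close> and
      \<open>?F (?qg s) \<in> V\<close> agree; \<open>qg\<close> supplies the carrier
      condition.\<close>
    moreover have "{s \<in> ?Sg. ?T s \<in> ?W} = {s \<in> ?Sg. ?qg s \<in> {x \<in> carrier ?Ug. ?F x \<in> V}}"
      using q qg tensor_map_symmetric[of \<phi> scale_g scale_h, OF add scale] by auto
    ultimately show ?thesis unfolding openin_env_topology by auto
  qed
  then show ?thesis using closed by (simp add: continuous_map image_subset_iff)
qed

end

theorem proposition5p3p16:
  fixes R :: real and z :: "'k::real_normed_field"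
    and scale_g :: "'k \<Rightarrow> 'g::{topological_ab_group_add, t2_space} \<Rightarrow> 'g"
    and scale_h :: "'k \<Rightarrow> 'h::{topological_ab_group_add, t2_space} \<Rightarrow> 'h"
    and bracket_g :: "'g \<Rightarrow> 'g \<Rightarrow> 'g" and bracket_h :: "'h \<Rightarrow> 'h \<Rightarrow> 'h"
    and \<phi> :: "'g \<Rightarrow> 'h"
  assumes "R \<ge> 1"
    and "AE_lie_algebra scale_g bracket_g"
    and "AE_lie_algebra scale_h bracket_h"
    and "lie_algebra_hom scale_g bracket_g scale_h bracket_h \<phi>"
    and "continuous_on UNIV \<phi>"
  shows "\<exists>\<Phi> \<in> algebra_hom (env_algebra scale_g bracket_g z) (env_algebra scale_h bracket_h z).
    continuous_map (env_topology scale_g bracket_g R z) (env_topology scale_h bracket_h R z) \<Phi> \<and>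
    (\<forall>x. \<Phi> (env_incl scale_g bracket_g z x) = env_incl scale_h bracket_h z (\<phi> x))"
proof -
  let ?\<Phi> = "env_map scale_h bracket_h z \<phi>"
  have linear: "Vector_Spaces.linear scale_g scale_h \<phi>"
    and bracket: "\<And>x y. \<phi> (bracket_g x y) = bracket_h (\<phi> x) (\<phi> y)"
    using assms(4) by (auto simp: lie_algebra_hom_def)
  interpret Vector_Spaces.linear scale_g scale_h \<phi> by (rule linear)
  \<comment> \<open>\<open>env_incl\<close> is the coset of \<open>tensor_incl\<close>, and
    \<open>tensor_map\<close> acts on \<open>tensor_incl\<close> through
    \<open>\<phi>\<close>.\<close>
  have "?\<Phi> (env_incl scale_g bracket_g z x) = env_incl scale_h bracket_h z (\<phi> x)" for x
    unfolding env_incl_def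
      env_map_coset[of \<phi> scale_g scale_h bracket_g bracket_h, OF add scale bracket tensor_incl_mem]
      tensor_map_incl[of \<phi> scale_g scale_h, OF add scale] ..
  moreover have "?\<Phi> \<in> algebra_hom (env_algebra scale_g bracket_g z) (env_algebra scale_h bracket_h z)"
    by (rule env_map_hom[of \<phi> scale_g scale_h bracket_g bracket_h, OF add scale bracket])
  ultimately show ?thesis
    using continuous_map_env_map[of scale_g scale_h \<phi> bracket_g bracket_h, OF linear assms(5) bracket] by blast
qed

end
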